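(* Each of the following holds. (1) There are unsatisfiable CNF formulas $F_N$ over $N$ variables of size $S(F_N)=\mathrm{poly}(N)$ such that resolution refutes $F_N$ in width $W(F_N\vdash\perp)=o(\log N)$, but any treelike resolution refutation of $F_N$ of width at most $1.4\,W(F_N\vdash\perp)$ has size at least $\exp\bigl(S(F_N)^{2.4}\bigr)$. (2) There are unsatisfiable CNF formulas $F_N$ over $N$ variables of size $S(F_N)=\mathrm{poly}(N)$ such that resolution refutes $F_N$ in width $W(F_N\vdash\perp)=o\bigl((\log N)^{3/2}\bigr)$, but any treelike resolution refutation of $F_N$ of width at most $W(F_N\vdash\perp)+40\frac{\log N}{\log\log N}$ has size at least $\exp\bigl(S(F_N)^{\omega(1)}\bigr)$.
   Context: A clause is a disjunction of literals over distinct variables; its width is its number of literals. A CNF formula is a set of clauses; its size $S(F)$ is the sum of the widths of its clauses. A resolution refutation of $F$ is a sequence of clauses ending in the empty clause, each clause being in $F$ or derived from two earlier clauses $C\lor x$, $D\lor\neg x$ as $C\lor D$. Its size is the number of clauses, its width the maximum width of a clause in it. It is treelike if its associated DAG (edges from premises to derived clause) is a tree, i.e. each derived clause is used at most once as a premise. $W(F\vdash\perp)$ is the minimum width of a resolution refutation of $F$. *)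

theory Defs
  imports Complex_Main "HOL-Library.Landau_Symbols"
begin

datatype 'v literal = Pos 'v | Neg 'v

fun var_of :: "'v literal \<Rightarrow> 'v" where
  "var_of (Pos x) = x"
| "var_of (Neg x) = x"

fun lit_true :: "('v \<Rightarrow> bool) \<Rightarrow> 'v literal \<Rightarrow> bool" where
  "lit_true \<alpha> (Pos x) \<longleftrightarrow> \<alpha> x"
| "lit_true \<alpha> (Neg x) \<longleftrightarrow> \<not> \<alpha> x"

type_synonym 'v clause = "'v literal set"
type_synonym 'v cnf = "'v clause set"

(* "Literals over distinct variables": in particular, tautologies are not clauses. *)
definition is_clause :: "'v clause \<Rightarrow> bool" where
  "is_clause C \<longleftrightarrow> finite C \<and> inj_on var_of C"

definition is_cnf :: "'v cnf \<Rightarrow> bool" where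
  "is_cnf F \<longleftrightarrow> finite F \<and> (\<forall>C\<in>F. is_clause C)"

definition clause_width :: "'v clause \<Rightarrow> nat" where
  "clause_width C = card C"

definition cnf_size :: "'v cnf \<Rightarrow> nat" where
  "cnf_size F = (\<Sum>C\<in>F. clause_width C)"

definition cnf_vars :: "'v cnf \<Rightarrow> 'v set" where
  "cnf_vars F = (\<Union>C\<in>F. var_of ` C)"

definition satisfiable :: "'v cnf \<Rightarrow> bool" where
  "satisfiable F \<longleftrightarrow> (\<exists>\<alpha>. \<forall>C\<in>F. \<exists>l\<in>C. lit_true \<alpha> l)"

definition resolvent :: "'v clause \<Rightarrow> 'v clause \<Rightarrow> 'v clause \<Rightarrow> bool" where
  "resolvent A B E \<longleftrightarrow>
     (\<exists>x C D. Pos x \<notin> C \<and> Neg x \<notin> D \<and>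
        A = insert (Pos x) C \<and> B = insert (Neg x) D \<and> E = C \<union> D)"

(* A line of a refutation records how it was obtained, so that the associated DAG is
   determined by the sequence; in Resolve i j, i and j are positions of earlier lines. *)
datatype rule_app = Axiom | Resolve nat nat

fun premises_of :: "rule_app \<Rightarrow> nat set" where
  "premises_of Axiom = {}"
| "premises_of (Resolve i j) = {i, j}"

type_synonym 'v derivation = "('v clause \<times> rule_app) list"

abbreviation clause_at :: "'v derivation \<Rightarrow> nat \<Rightarrow> 'v clause" where
  "clause_at \<pi> k \<equiv> fst (\<pi> ! k)"

abbreviation rule_at :: "'v derivation \<Rightarrow> nat \<Rightarrow> rule_app" where
  "rule_at \<pi> k \<equiv> snd (\<pi> ! k)"

definition valid_line :: "'v cnf \<Rightarrow> 'v derivation \<Rightarrow> nat \<Rightarrow> bool" where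
  "valid_line F \<pi> k \<longleftrightarrow> is_clause (clause_at \<pi> k) \<and>
     (case rule_at \<pi> k of
        Axiom \<Rightarrow> clause_at \<pi> k \<in> F
      | Resolve i j \<Rightarrow> i < k \<and> j < k \<and>
          resolvent (clause_at \<pi> i) (clause_at \<pi> j) (clause_at \<pi> k))"

definition refutation :: "'v cnf \<Rightarrow> 'v derivation \<Rightarrow> bool" where
  "refutation F \<pi> \<longleftrightarrow>
     \<pi> \<noteq> [] \<and> fst (last \<pi>) = {} \<and> (\<forall>k<length \<pi>. valid_line F \<pi> k)"

definition ref_size :: "'v derivation \<Rightarrow> nat" where
  "ref_size \<pi> = length \<pi>"

definition ref_width :: "'v derivation \<Rightarrow> nat" where
  "ref_width \<pi> = Max (clause_width ` fst ` set \<pi>)"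

(* Only derived lines are restricted: axiom lines may be premises repeatedly. This
   includes every derivation whose DAG is a tree in the strict sense. *)
definition treelike :: "'v derivation \<Rightarrow> bool" where
  "treelike \<pi> \<longleftrightarrow>
     (\<forall>k<length \<pi>. rule_at \<pi> k \<noteq> Axiom \<longrightarrow>
        card {m. m < length \<pi> \<and> k \<in> premises_of (rule_at \<pi> m)} \<le> 1)"

(* Meaningful for unsatisfiable F only; otherwise there is no refutation. *)
definition min_width :: "'v cnf \<Rightarrow> nat" where
  "min_width F = (LEAST w. \<exists>\<pi>. refutation F \<pi> \<and> ref_width \<pi> = w)"

(* "Unsatisfiable CNF formulas F N over N variables of size poly(N)". Exactly N variables
   occur: if fewer were allowed, F N = {{}} would meet the lower bounds trivially. *)
definition unsat_family :: "(nat \<Rightarrow> 'v cnf) \<Rightarrow> bool" where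
  "unsat_family F \<longleftrightarrow>
     (\<forall>N. is_cnf (F N) \<and> \<not> satisfiable (F N) \<and> card (cnf_vars (F N)) = N) \<and>
     (\<exists>c::nat. (\<lambda>N. real (cnf_size (F N))) \<in> O(\<lambda>N. real N ^ c))"

end

theory Submission
  imports Defs "HOL-Library.Nat_Bijection" "HOL-Real_Asymp.Real_Asymp" "HOL-Number_Theory.Cong"
begin

text \<open>
  A cylinder of \<open>k\<close> layers arranged in a cycle carries a system of parity equations whose only
  inconsistency is between a ring of edges at position \<open>0\<close> and another one at position \<open>T\<close>. Moving a
  staircase-shaped cut along the cylinder refutes it in width about \<open>k\<close>. Now compress the cylinder:
  take coprime moduli \<open>p j\<close> of size about \<open>Z\<close> and identify the positions in gap \<open>g\<close> modulo the
  product of those \<open>R\<close> moduli \<open>p j\<close> for which \<open>g\<close> lies in the \<open>j\<close>-th cyclic arc of \<open>R\<close> gaps. This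
  leaves about \<open>Z ^ R\<close> variables, whereas positions are still distinguished modulo about \<open>Z ^ k\<close>:
  a closed walk around the cylinder with fewer than \<open>k + R\<close> edges has, in every arc, a gap that it
  crosses in a single edge, and by the Chinese remainder theorem these edges determine its position up
  to a small error. So a refutation of width less than \<open>k + R\<close> has to move its cut over a distance of
  about \<open>Z ^ k\<close> in small steps. Replacing each variable by the exclusive or of \<open>b\<close> copies makes every
  such step branch in both directions, and a treelike refutation has size exponential in \<open>Z ^ k\<close>.
\<close>

subsection \<open>Derivability in bounded width\<close>

text \<open>What drives the lower bound is that a locally consistent assignment has exactly one
  flaw, and that this flaw can be relocated. Edge values are differences of potentials plus jumps
  across the gaps; all local equations then hold, and the parity of the jumps decides which of the
  two ring equations fails. The rings lie half a period apart, so when the edges remembered by a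
  clause first reveal a position on the cylinder, the flaw can be put at the ring that is about a
  quarter of a period away or more. Afterwards the position moves by at most \<open>slack\<close>
  per step, and the number of moves left is the depth of a complete binary tree inside the
  refutation. Branching needs both premises of a step to stay compatible with the flawed assignment.
  Therefore an edge counts against the width as soon as \<open>b - 1\<close> of its \<open>b\<close>
  copies are mentioned, while its value is fixed only by the last copy. The widths compared are thus
  \<open>b * (k + 4)\<close> and \<open>(b - 1) * (k + R - 1)\<close>. Against about
  \<open>Z ^ R\<close> variables the depth is about \<open>Z ^ k\<close>, so \<open>k / R\<close> is
  the exponent gained.\<close>

inductive derivable :: "'v cnf \<Rightarrow> nat \<Rightarrow> 'v clause \<Rightarrow> bool" for F w where
  ax: "\<lbrakk>C \<in> F; is_clause C; card C \<le> w\<rbrakk> \<Longrightarrow> derivable F w C"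
| res: "\<lbrakk>derivable F w A; derivable F w B; resolvent A B E; is_clause E; card E \<le> w\<rbrakk>
    \<Longrightarrow> derivable F w E"

definition derivation_within :: "'v cnf \<Rightarrow> nat \<Rightarrow> 'v derivation \<Rightarrow> bool" where
  "derivation_within F w \<pi> \<longleftrightarrow>
     (\<forall>k<length \<pi>. valid_line F \<pi> k \<and> clause_width (clause_at \<pi> k) \<le> w)"

lemma valid_line_append:
  "k < length \<pi> \<Longrightarrow> valid_line F (\<pi> @ \<rho>) k \<longleftrightarrow> valid_line F \<pi> k"
  by (auto simp: valid_line_def nth_append split: rule_app.splits)

lemma derivation_within_snoc:
  assumes "derivation_within F w \<pi>" "valid_line F (\<pi> @ [(C, r)]) (length \<pi>)" "card C \<le> w"
  shows "derivation_within F w (\<pi> @ [(C, r)])"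
  using assms
  by (auto simp: derivation_within_def valid_line_append less_Suc_eq nth_append clause_width_def)

text \<open>Generalising over the prefix \<open>\<pi>\<close> lets the lines for the second premise
  be appended after those for the first without renumbering.\<close>

lemma derivable_extends:
  assumes "derivable F w C" "derivation_within F w \<pi>"
  shows "\<exists>\<rho>. derivation_within F w (\<pi> @ \<rho>) \<and> C \<in> fst ` set (\<pi> @ \<rho>)"
  using assms
proof (induction arbitrary: \<pi> rule: derivable.induct)
  case (ax C)
  have "derivation_within F w (\<pi> @ [(C, Axiom)])"
    using ax by (intro derivation_within_snoc) (auto simp: valid_line_def)
  then show ?case by (intro exI[of _ "[(C, Axiom)]"]) auto
next
  case (res A B E)
  obtain \<rho>1 where 1: "derivation_within F w (\<pi> @ \<rho>1)" "A \<in> fst ` set (\<pi> @ \<rho>1)"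
    using res.IH(1)[OF res.prems] by blast
  obtain \<rho>2 where 2: "derivation_within F w ((\<pi> @ \<rho>1) @ \<rho>2)" "B \<in> fst ` set ((\<pi> @ \<rho>1) @ \<rho>2)"
    using res.IH(2)[OF 1(1)] by blast
  define \<sigma> where "\<sigma> = (\<pi> @ \<rho>1) @ \<rho>2"
  have "A \<in> fst ` set \<sigma>" "B \<in> fst ` set \<sigma>" using 1 2 by (auto simp: \<sigma>_def)
  then obtain i j where ij: "i < length \<sigma>" "clause_at \<sigma> i = A" "j < length \<sigma>" "clause_at \<sigma> j = B"
    by (metis (no_types, lifting) image_iff in_set_conv_nth)
  have "derivation_within F w (\<sigma> @ [(E, Resolve i j)])"
  proof (rule derivation_within_snoc)
    show "derivation_within F w \<sigma>" using 2(1) by (simp add: \<sigma>_def)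
  qed (use res.hyps ij in \<open>auto simp: valid_line_def nth_append\<close>)
  then show ?case
    by (intro exI[of _ "\<rho>1 @ \<rho>2 @ [(E, Resolve i j)]"]) (auto simp: \<sigma>_def)
qed

lemma refutation_of_derivable:
  assumes "derivable F w {}"
  shows "\<exists>\<pi>. refutation F \<pi> \<and> ref_width \<pi> \<le> w"
proof -
  obtain \<rho> where \<rho>: "derivation_within F w \<rho>" "{} \<in> fst ` set \<rho>"
    using derivable_extends[OF assms, of "[]"] by (auto simp: derivation_within_def)
  then obtain i where i: "i < length \<rho>" "clause_at \<rho> i = {}"
    by (auto simp: in_set_conv_nth)
  define \<pi> where "\<pi> = take (Suc i) \<rho>"
  have len: "length \<pi> = Suc i" using i by (simp add: \<pi>_def)
  have eq: "\<rho> = \<pi> @ drop (Suc i) \<rho>" by (simp add: \<pi>_def)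
  have valid: "valid_line F \<pi> k" "clause_width (clause_at \<pi> k) \<le> w" if "k < length \<pi>" for k
  proof -
    have k: "k < length \<rho>" using that len i by simp
    show "valid_line F \<pi> k"
      using \<rho>(1) k valid_line_append[OF that, of F "drop (Suc i) \<rho>"]
      unfolding derivation_within_def eq[symmetric] by blast
    show "clause_width (clause_at \<pi> k) \<le> w"
      using \<rho>(1) k that len by (simp add: derivation_within_def \<pi>_def)
  qed
  have "fst (last \<pi>) = {}"
    using i by (simp add: take_Suc_conv_app_nth \<pi>_def)
  then have "refutation F \<pi>"
    using valid(1) len by (auto simp: refutation_def)
  moreover have "ref_width \<pi> \<le> w"
    unfolding ref_width_def using len valid(2)
    by (subst Max_le_iff) (auto simp: in_set_conv_nth split: prod.splits, metis fst_conv)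
  ultimately show ?thesis by blast
qed

lemma min_width_le_of_derivable:
  assumes "derivable F w {}"
  shows "min_width F \<le> w"
proof -
  obtain \<pi> where "refutation F \<pi>" "ref_width \<pi> \<le> w"
    using refutation_of_derivable[OF assms] by blast
  then show ?thesis
    unfolding min_width_def by (metis (mono_tags, lifting) Least_le le_trans)
qed

lemma derivable_sound:
  assumes "derivable F w C" "\<forall>C\<in>F. \<exists>l\<in>C. lit_true \<alpha> l"
  shows "\<exists>l\<in>C. lit_true \<alpha> l"
  using assms
proof (induction rule: derivable.induct)
  case (res A B E)
  then show ?case unfolding resolvent_def by fastforce
qed auto

lemma unsatisfiable_of_derivable: "derivable F w {} \<Longrightarrow> \<not> satisfiable F"
  using derivable_sound unfolding satisfiable_def by blast

definition falsified :: "('v \<Rightarrow> bool) \<Rightarrow> 'v clause \<Rightarrow> bool" where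
  "falsified \<alpha> C \<longleftrightarrow> (\<forall>l\<in>C. \<not> lit_true \<alpha> l)"

text \<open>Complementary literals cannot both be false, so any set of literals falsified by a
  single assignment is free of them.\<close>

lemma falsified_imp_is_clause:
  assumes "falsified \<alpha> C" "var_of ` C \<subseteq> V" "finite V"
  shows "is_clause C" "card C \<le> card V"
proof -
  have inj: "inj_on var_of C"
  proof (rule inj_onI)
    fix l m assume "l \<in> C" "m \<in> C" "var_of l = var_of m"
    moreover have "\<not> lit_true \<alpha> l" "\<not> lit_true \<alpha> m"
      using calculation assms(1) by (auto simp: falsified_def)
    ultimately show "l = m" by (cases l; cases m) auto
  qed
  then show "card C \<le> card V" "is_clause C"
    using assms(2,3) finite_imageD[OF finite_subset[OF assms(2,3)] inj]
    by (auto simp: is_clause_def card_inj_on_le)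
qed

text \<open>By resolving on the variables of \<open>V - U\<close> one at a time.\<close>

lemma derivable_project:
  assumes "finite V" "card (V \<union> U) \<le> w" "finite U"
    and dep: "\<And>\<alpha> \<beta>. (\<forall>x\<in>U. \<alpha> x = \<beta> x) \<Longrightarrow> Q \<alpha> = Q \<beta>"
    and cov: "\<And>\<alpha>. \<not> Q \<alpha> \<Longrightarrow> \<exists>C. derivable F w C \<and> var_of ` C \<subseteq> V \<union> U \<and> falsified \<alpha> C"
    and nQ: "\<not> Q \<alpha>"
  shows "\<exists>C. derivable F w C \<and> var_of ` C \<subseteq> U \<and> falsified \<alpha> C"
proof -
  have "\<forall>\<alpha>. \<not> Q \<alpha> \<longrightarrow> (\<exists>C. derivable F w C \<and> var_of ` C \<subseteq> U \<and> falsified \<alpha> C)"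
    using assms(1,2) cov
  proof (induction V rule: finite_induct)
    case empty then show ?case by simp
  next
    case (insert x V)
    show ?case
    proof (rule insert.IH)
      have fin: "finite (V \<union> U)" using insert assms by simp
      then show card: "card (V \<union> U) \<le> w"
        using insert.prems(1) by (metis card_insert_le le_trans Un_insert_left)
      fix \<alpha> assume nQ: "\<not> Q \<alpha>"
      show "\<exists>C. derivable F w C \<and> var_of ` C \<subseteq> V \<union> U \<and> falsified \<alpha> C"
      proof (cases "x \<in> U")
        case True
        then show ?thesis using insert.prems(2)[OF nQ] by auto
      next
        case False
        \<comment> \<open>\<open>Q\<close> does not depend on \<open>x\<close>, so both values of
          \<open>x\<close> come with a derivable falsified clause. Unless one of these clauses is
          already free of \<open>x\<close>, they clash exactly on \<open>x\<close>.\<close>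
        have "\<not> Q (\<alpha>(x := v))" for v
          using nQ dep[of \<alpha> "\<alpha>(x := v)"] False by auto
        then obtain A B where
          A: "derivable F w A" "var_of ` A \<subseteq> insert x (V \<union> U)" "falsified (\<alpha>(x := False)) A" and
          B: "derivable F w B" "var_of ` B \<subseteq> insert x (V \<union> U)" "falsified (\<alpha>(x := True)) B"
          using insert.prems(2) by (metis Un_insert_left)
        have A': "l = Pos x \<or> var_of l \<in> V \<union> U \<and> \<not> lit_true \<alpha> l" if "l \<in> A" for l
        proof -
          have "var_of l \<in> insert x (V \<union> U)" "\<not> lit_true (\<alpha>(x := False)) l"
            using that A(2,3) by (auto simp: falsified_def)
          then show ?thesis by (cases l) (auto split: if_splits)
        qed
        have B': "l = Neg x \<or> var_of l \<in> V \<union> U \<and> \<not> lit_true \<alpha> l" if "l \<in> B" for l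
        proof -
          have "var_of l \<in> insert x (V \<union> U)" "\<not> lit_true (\<alpha>(x := True)) l"
            using that B(2,3) by (auto simp: falsified_def)
          then show ?thesis by (cases l) (auto split: if_splits)
        qed
        show ?thesis
        proof (cases "Pos x \<in> A \<and> Neg x \<in> B")
          case False
          then consider "Pos x \<notin> A" | "Neg x \<notin> B" by blast
          then show ?thesis
          proof cases
            case 1
            then have "var_of ` A \<subseteq> V \<union> U \<and> falsified \<alpha> A"
              using A' unfolding falsified_def by blast
            with A(1) show ?thesis by blast
          next
            case 2
            then have "var_of ` B \<subseteq> V \<union> U \<and> falsified \<alpha> B"
              using B' unfolding falsified_def by blast
            with B(1) show ?thesis by blast
          qed
        next
          case True
          define E where "E = (A - {Pos x}) \<union> (B - {Neg x})"
          have E: "var_of ` E \<subseteq> V \<union> U" "falsified \<alpha> E"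
            using A' B' unfolding falsified_def E_def by blast+
          have "resolvent A B E"
            unfolding resolvent_def E_def using True
            by (intro exI[of _ x] exI[of _ "A - {Pos x}"] exI[of _ "B - {Neg x}"]) auto
          then have "derivable F w E"
            using A(1) B(1) falsified_imp_is_clause[OF E(2,1) fin] card
            by (auto intro: derivable.res)
          then show ?thesis using E by blast
        qed
      qed
    qed
  qed
  then show ?thesis using nQ by blast
qed

subsection \<open>Subtrees of treelike refutations\<close>

definition premise_rel :: "'v derivation \<Rightarrow> (nat \<times> nat) set" where
  "premise_rel \<pi> = {(i, k). k < length \<pi> \<and> i \<in> premises_of (rule_at \<pi> k)}"

text \<open>Axiom lines may be shared in a treelike derivation, so only derived lines are
  counted.\<close>

definition derived_below :: "'v derivation \<Rightarrow> nat \<Rightarrow> nat set" where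
  "derived_below \<pi> k = {m. m < length \<pi> \<and> rule_at \<pi> m \<noteq> Axiom \<and> (m, k) \<in> (premise_rel \<pi>)\<^sup>*}"

lemma derived_below_finite [simp]: "finite (derived_below \<pi> k)"
  by (simp add: derived_below_def)

lemma premise_rel_less:
  assumes "refutation F \<pi>" "(i, k) \<in> premise_rel \<pi>"
  shows "i < k"
proof -
  have "valid_line F \<pi> k" using assms by (auto simp: refutation_def premise_rel_def)
  then show ?thesis
    using assms(2) by (cases "rule_at \<pi> k") (auto simp: valid_line_def premise_rel_def)
qed

lemma premise_rel_rtrancl_le:
  assumes "refutation F \<pi>" "(i, k) \<in> (premise_rel \<pi>)\<^sup>*"
  shows "i \<le> k"
  using assms(2)
proof (induction rule: rtrancl_induct)
  case (step y z)
  then show ?case using premise_rel_less[OF assms(1), of y z] by simp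
qed simp

lemma treelike_unique_conclusion:
  assumes "treelike \<pi>" "rule_at \<pi> m \<noteq> Axiom" "m < length \<pi>"
    "(m, k) \<in> premise_rel \<pi>" "(m, k') \<in> premise_rel \<pi>"
  shows "k = k'"
proof -
  let ?S = "{n. n < length \<pi> \<and> m \<in> premises_of (rule_at \<pi> n)}"
  have "card ?S \<le> 1" using assms unfolding treelike_def by blast
  moreover have "k \<in> ?S" "k' \<in> ?S" using assms by (auto simp: premise_rel_def)
  moreover have "finite ?S" by (rule finite_subset[of _ "{..<length \<pi>}"]) auto
  ultimately show ?thesis unfolding One_nat_def card_le_Suc0_iff_eq[OF \<open>finite ?S\<close>] by blast
qed

lemma rtrancl_imp_derived:
  assumes "(m, k) \<in> (premise_rel \<pi>)\<^sup>*" "rule_at \<pi> m \<noteq> Axiom"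
  shows "rule_at \<pi> k \<noteq> Axiom"
  using assms by (induction rule: rtrancl_induct) (auto simp: premise_rel_def)

text \<open>Going up from a derived line there is only one path, so two lines above it are comparable.\<close>

lemma derived_below_comparable:
  assumes ref: "refutation F \<pi>" and tree: "treelike \<pi>"
    and m: "m < length \<pi>" "rule_at \<pi> m \<noteq> Axiom"
    and i: "(m, i) \<in> (premise_rel \<pi>)\<^sup>*" and j: "(m, j) \<in> (premise_rel \<pi>)\<^sup>*"
  shows "(i, j) \<in> (premise_rel \<pi>)\<^sup>* \<or> (j, i) \<in> (premise_rel \<pi>)\<^sup>*"
  using i
proof (induction rule: rtrancl_induct)
  case base then show ?case using j by blast
next
  case (step y z)
  show ?case
  proof (cases "(y, j) \<in> (premise_rel \<pi>)\<^sup>*")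
    case False
    then show ?thesis using step by (meson rtrancl.rtrancl_into_rtrancl)
  next
    case True
    then show ?thesis
    proof (cases rule: converse_rtranclE)
      case base then show ?thesis using step by blast
    next
      case (step y')
      have "rule_at \<pi> y \<noteq> Axiom" using \<open>(m, y) \<in> _\<close> m by (metis rtrancl_imp_derived)
      moreover have "y < length \<pi>"
        using premise_rel_less[OF ref \<open>(y, z) \<in> _\<close>] \<open>(y, z) \<in> _\<close> by (auto simp: premise_rel_def)
      ultimately have "y' = z"
        using treelike_unique_conclusion[OF tree] \<open>(y, z) \<in> _\<close> step by blast
      then show ?thesis using step by blast
    qed
  qed
qed

text \<open>A common line would make \<open>i\<close> and \<open>j\<close> comparable. A path from
  \<open>i\<close> up to \<open>j\<close> has to start with the only conclusion of \<open>i\<close>,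
  which is \<open>k\<close>, but \<open>k\<close> comes after \<open>j\<close>.\<close>

lemma derived_below_disjoint:
  assumes ref: "refutation F \<pi>" and tree: "treelike \<pi>" and k: "k < length \<pi>"
    and rule: "rule_at \<pi> k = Resolve i j" and "i \<noteq> j"
  shows "derived_below \<pi> i \<inter> derived_below \<pi> j = {}"
proof -
  have no: False if path: "(i, j) \<in> (premise_rel \<pi>)\<^sup>*" "i \<noteq> j" and use: "rule_at \<pi> i \<noteq> Axiom"
    "(i, k) \<in> premise_rel \<pi>" "(j, k) \<in> premise_rel \<pi>" for i j
  proof -
    obtain y where y: "(i, y) \<in> premise_rel \<pi>" "(y, j) \<in> (premise_rel \<pi>)\<^sup>*"
      using path by (metis converse_rtranclE)
    have "i < length \<pi>" using premise_rel_less[OF ref use(2)] k by simp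
    then have "y = k" using treelike_unique_conclusion[OF tree use(1)] y use by blast
    then have "k \<le> j" using premise_rel_rtrancl_le[OF ref y(2)] by simp
    then show False using premise_rel_less[OF ref use(3)] by simp
  qed
  have ik: "(i, k) \<in> premise_rel \<pi>" "(j, k) \<in> premise_rel \<pi>"
    using k rule by (auto simp: premise_rel_def)
  show ?thesis
  proof (rule ccontr)
    assume "\<not> ?thesis"
    then obtain m where m: "m \<in> derived_below \<pi> i" "m \<in> derived_below \<pi> j" by blast
    then have "rule_at \<pi> i \<noteq> Axiom" "rule_at \<pi> j \<noteq> Axiom"
      by (auto simp: derived_below_def rtrancl_imp_derived)
    moreover have "(i, j) \<in> (premise_rel \<pi>)\<^sup>* \<or> (j, i) \<in> (premise_rel \<pi>)\<^sup>*"
      using m by (intro derived_below_comparable[OF ref tree, of m]) (auto simp: derived_below_def)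
    ultimately show False using no ik \<open>i \<noteq> j\<close> by metis
  qed
qed

lemma is_clause_Pos_Neg: "is_clause C \<Longrightarrow> \<not> (Pos x \<in> C \<and> Neg x \<in> C)"
  unfolding is_clause_def using inj_onD[of var_of C "Pos x" "Neg x"] by auto

text \<open>Here the ban on tautologies matters: the two premises occupy different lines, so their
  subtrees can be added up.\<close>

lemma resolvent_distinct:
  assumes "resolvent A B E" "is_clause A" "is_clause B"
  shows "A \<noteq> B"
  using assms is_clause_Pos_Neg[of A] unfolding resolvent_def by (metis insertI1)

text \<open>The counter \<open>d\<close> drops only where both premises inherit \<open>G\<close>, so the derivation
  of a line with \<open>G\<close> contains a complete binary tree of depth \<open>d\<close>.\<close>

lemma treelike_size_lower_bound:
  assumes ref: "refutation F \<pi>" and tree: "treelike \<pi>" and w: "ref_width \<pi> \<le> w"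
    and axiom: "\<And>C d. C \<in> F \<Longrightarrow> G C d \<Longrightarrow> d = 0"
    and step: "\<And>A B E d. \<lbrakk>resolvent A B E; is_clause A; is_clause B; is_clause E;
        card A \<le> w; card B \<le> w; card E \<le> w; G E (Suc d); Suc d \<le> D\<rbrakk> \<Longrightarrow>
        G A (Suc d) \<or> G B (Suc d) \<or> G A d \<and> G B d"
    and root: "G {} D"
  shows "2 ^ D - 1 \<le> ref_size \<pi>"
proof -
  have valid: "valid_line F \<pi> k" if "k < length \<pi>" for k
    using ref that by (auto simp: refutation_def)
  have width: "card (clause_at \<pi> k) \<le> w" if "k < length \<pi>" for k
  proof -
    have "clause_width (clause_at \<pi> k) \<le> ref_width \<pi>"
      unfolding ref_width_def using that by (intro Max_ge) auto
    then show ?thesis using w by (simp add: clause_width_def)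
  qed
  have main: "2 ^ d - 1 \<le> card (derived_below \<pi> k)"
    if "k < length \<pi>" "G (clause_at \<pi> k) d" "d \<le> D" for k d
    using that
  proof (induction k arbitrary: d rule: less_induct)
    case (less k)
    show ?case
    proof (cases d)
      case (Suc d')
      show ?thesis
      proof (cases "rule_at \<pi> k")
        case Axiom
        then have "clause_at \<pi> k \<in> F" using valid less.prems by (fastforce simp: valid_line_def)
        then have "d = 0" using axiom less.prems(2) by blast
        then show ?thesis by simp
      next
        case (Resolve i j)
        then have ij: "i < k" "j < k" "resolvent (clause_at \<pi> i) (clause_at \<pi> j) (clause_at \<pi> k)"
          using valid less.prems by (fastforce simp: valid_line_def)+
        then have ij': "i < length \<pi>" "j < length \<pi>" using less.prems by auto
        have cl: "is_clause (clause_at \<pi> i)" "is_clause (clause_at \<pi> j)" "is_clause (clause_at \<pi> k)"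
          using valid less.prems ij' by (auto simp: valid_line_def)
        have neq: "i \<noteq> j" using resolvent_distinct[OF ij(3) cl(1,2)] by auto
        have rel: "(i, k) \<in> premise_rel \<pi>" "(j, k) \<in> premise_rel \<pi>"
          using Resolve less.prems by (auto simp: premise_rel_def)
        then have sub: "derived_below \<pi> i \<subseteq> derived_below \<pi> k" "derived_below \<pi> j \<subseteq> derived_below \<pi> k"
          by (auto simp: derived_below_def intro: rtrancl_into_rtrancl)
        have k: "k \<in> derived_below \<pi> k" "k \<notin> derived_below \<pi> i" "k \<notin> derived_below \<pi> j"
          using Resolve less.prems premise_rel_rtrancl_le[OF ref] ij
          by (force simp: derived_below_def)+
        have "G (clause_at \<pi> i) d \<or> G (clause_at \<pi> j) d \<or>
          G (clause_at \<pi> i) d' \<and> G (clause_at \<pi> j) d'"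
          using step[OF ij(3) cl] width ij' less.prems Suc by blast
        then consider "G (clause_at \<pi> i) d" | "G (clause_at \<pi> j) d" |
          "G (clause_at \<pi> i) d'" "G (clause_at \<pi> j) d'" by blast
        then show ?thesis
        proof cases
          case 1
          then show ?thesis
            using less.IH[OF ij(1) ij'(1) 1 less.prems(3)] card_mono[OF _ sub(1)] by force
        next
          case 2
          then show ?thesis
            using less.IH[OF ij(2) ij'(2) 2 less.prems(3)] card_mono[OF _ sub(2)] by force
        next
          case 3
          \<comment> \<open>Line \<open>k\<close> and two disjoint subtrees:
            \<open>1 + 2 * (2 ^ d' - 1) = 2 ^ d - 1\<close>.\<close>
          have "card (insert k (derived_below \<pi> i \<union> derived_below \<pi> j)) \<le> card (derived_below \<pi> k)"
            using sub k by (intro card_mono) auto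
          moreover have "card (derived_below \<pi> i \<union> derived_below \<pi> j) =
            card (derived_below \<pi> i) + card (derived_below \<pi> j)"
            using derived_below_disjoint[OF ref tree less.prems(1) Resolve neq]
            by (intro card_Un_disjoint) auto
          moreover have "2 ^ d' - 1 \<le> card (derived_below \<pi> i)" "2 ^ d' - 1 \<le> card (derived_below \<pi> j)"
            using less.IH ij ij' 3 less.prems(3) Suc by auto
          moreover have "(1::nat) \<le> 2 ^ d'" by simp
          ultimately show ?thesis using k Suc by simp
        qed
      qed
    qed simp
  qed
  have "length \<pi> - 1 < length \<pi>" "clause_at \<pi> (length \<pi> - 1) = {}"
    using ref by (auto simp: refutation_def last_conv_nth)
  then have "2 ^ D - 1 \<le> card (derived_below \<pi> (length \<pi> - 1))" using main root by simp
  also have "\<dots> \<le> card {..<length \<pi>}"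
    by (intro card_mono) (auto simp: derived_below_def)
  finally show ?thesis by (simp add: ref_size_def)
qed

section \<open>Simultaneous congruences with integer moduli\<close>

lemma chinese_remainder_int:
  fixes m :: "'i \<Rightarrow> int"
  assumes "finite A" "\<And>i j. \<lbrakk>i \<in> A; j \<in> A; i \<noteq> j\<rbrakk> \<Longrightarrow> coprime (m i) (m j)"
  shows "\<exists>x. \<forall>i\<in>A. [x = u i] (mod m i)"
  using assms
proof (induction A rule: finite_induct)
  case (insert j A)
  then obtain x where x: "\<forall>i\<in>A. [x = u i] (mod m i)" by auto
  have "coprime (m j) (\<Prod>i\<in>A. m i)"
    using insert by (intro prod_coprime_right) auto
  then obtain y where y: "[y = u j] (mod m j)" "[y = x] (mod (\<Prod>i\<in>A. m i))"
    using binary_chinese_remainder_int by blast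
  have "[y = u i] (mod m i)" if "i \<in> A" for i
  proof -
    have "m i dvd (\<Prod>i\<in>A. m i)" using that insert by (intro dvd_prodI) auto
    with y(2) have "[y = x] (mod m i)" by (rule cong_dvd_modulus)
    then show ?thesis using x that by (blast intro: cong_trans)
  qed
  then show ?case using y by auto
qed auto

subsection \<open>The compressed cylinder\<close>

text \<open>Layers and gaps are indexed cyclically by \<open>{0..<k}\<close>; gap \<open>g\<close> lies between the layers \<open>g\<close> and
  \<open>g + 1\<close>. \<open>Rung g a\<close> crosses gap \<open>g\<close> at position \<open>a\<close>, \<open>Step i a\<close> joins the positions \<open>a\<close> and
  \<open>a + 1\<close> of layer \<open>i\<close>.\<close>

datatype edge = Rung nat int | Step nat int

locale cylinder =
  fixes k R :: nat and P :: int and p :: "nat \<Rightarrow> int"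
  assumes R_pos: "0 < R" and R_less: "R < k"
    and P_ge: "2 * int (k + R) \<le> P"
    and p_pos: "\<And>j. j < k \<Longrightarrow> 0 < p j"
    and coprime_P: "\<And>j. j < k \<Longrightarrow> coprime P (p j)"
    and coprime_p: "\<And>i j. \<lbrakk>i < k; j < k; i \<noteq> j\<rbrakk> \<Longrightarrow> coprime (p i) (p j)"
begin

definition nxt :: "nat \<Rightarrow> nat" where "nxt g = (g + 1) mod k"
definition prv :: "nat \<Rightarrow> nat" where "prv g = (g + k - 1) mod k"
definition arc :: "nat \<Rightarrow> nat set" where "arc j = (\<lambda>x. (j + x) mod k) ` {..<R}"
text \<open>The common factor \<open>P\<close> makes positions in different gaps comparable; as it
  exceeds \<open>2 * slack\<close>, a displacement of at most \<open>slack\<close> is determined by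
  its residue modulo \<open>P\<close>.\<close>

definition gapmod :: "nat \<Rightarrow> int" where "gapmod g = P * (\<Prod>j | j < k \<and> g \<in> arc j. p j)"
text \<open>The finest identification of the points of layer \<open>i\<close> under which the rungs
  of both adjacent gaps have well-defined endpoints.\<close>

definition laymod :: "nat \<Rightarrow> int" where "laymod i = gcd (gapmod i) (gapmod (prv i))"
definition period :: int where "period = P * (\<Prod>j<k. p j)"
definition rung :: "nat \<Rightarrow> int \<Rightarrow> edge" where "rung g a = Rung g (a mod gapmod g)"
definition step :: "nat \<Rightarrow> int \<Rightarrow> edge" where "step i a = Step i (a mod laymod i)"

definition edges :: "edge set" where
  "edges = {Rung g a |g a. g < k \<and> a \<in> {0..<gapmod g}} \<union> {Step i a |i a. i < k \<and> a \<in> {0..<laymod i}}"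

text \<open>The number of edges up to which every arc keeps a gap crossed only once. It also bounds
  the error of a location and the drift in one step.\<close>

definition slack :: nat where "slack = k + R - 1"

lemma k_pos: "0 < k" using R_less by simp
lemma P_pos: "0 < P" using P_ge R_less by simp

lemma nxt_less [simp]: "nxt g < k" using k_pos by (simp add: nxt_def)
lemma prv_less [simp]: "prv g < k" using k_pos by (simp add: prv_def)

lemma prv_nxt [simp]: "g < k \<Longrightarrow> prv (nxt g) = g"
proof -
  assume "g < k"
  then consider "g + 1 = k" | "g + 1 < k" by linarith
  then show ?thesis by cases (use k_pos in \<open>auto simp: nxt_def prv_def\<close>)
qed

lemma gapmod_pos: "0 < gapmod g"
  unfolding gapmod_def using P_pos p_pos by (intro mult_pos_pos prod_pos) auto

lemma laymod_pos: "0 < laymod i"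
  using gapmod_pos[of i] by (simp add: laymod_def)

lemma laymod_dvd: "laymod i dvd gapmod i" "g < k \<Longrightarrow> laymod (nxt g) dvd gapmod g"
  by (auto simp: laymod_def)

lemma P_dvd_gapmod: "P dvd gapmod g"
  by (simp add: gapmod_def)

lemma P_dvd_laymod: "P dvd laymod i"
  by (simp add: laymod_def P_dvd_gapmod)

lemma Pp_dvd_gapmod:
  assumes "j < k" "g \<in> arc j"
  shows "P * p j dvd gapmod g"
  unfolding gapmod_def using assms by (intro mult_dvd_mono dvd_refl dvd_prodI) auto

lemma period_pos: "0 < period"
  unfolding period_def using P_pos p_pos by (intro mult_pos_pos prod_pos) auto

lemma finite_edges: "finite edges"
proof -
  have "edges = (\<Union>g\<in>{..<k}. Rung g ` {0..<gapmod g}) \<union> (\<Union>i\<in>{..<k}. Step i ` {0..<laymod i})"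
    by (auto simp: edges_def)
  then show ?thesis by simp
qed

lemma rung_in_edges [simp]: "g < k \<Longrightarrow> rung g a \<in> edges"
  using gapmod_pos by (simp add: rung_def edges_def)

lemma step_in_edges [simp]: "i < k \<Longrightarrow> step i a \<in> edges"
  using laymod_pos by (simp add: step_def edges_def)

text \<open>The pseudo-assignment given by potentials \<open>B\<close> on the points of the layers and a jump \<open>c g\<close>
  across each gap. It satisfies all local equations.\<close>

fun pseudo :: "(nat \<Rightarrow> int \<Rightarrow> bool) \<Rightarrow> (nat \<Rightarrow> bool) \<Rightarrow> edge \<Rightarrow> bool" where
  "pseudo B c (Rung g a) = ((B g (a mod laymod g) \<noteq> B (nxt g) (a mod laymod (nxt g))) \<noteq> c g)"
| "pseudo B c (Step i a) = (B i (a mod laymod i) \<noteq> B i ((a + 1) mod laymod i))"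

definition odd_jump :: "(nat \<Rightarrow> bool) \<Rightarrow> bool" where
  "odd_jump c \<longleftrightarrow> odd (card {g. g < k \<and> c g})"

lemma pseudo_rung: "g < k \<Longrightarrow>
  pseudo B c (rung g a) = ((B g (a mod laymod g) \<noteq> B (nxt g) (a mod laymod (nxt g))) \<noteq> c g)"
  by (simp add: rung_def mod_mod_cancel laymod_dvd)

lemma pseudo_step: "pseudo B c (step i a) = (B i (a mod laymod i) \<noteq> B i ((a + 1) mod laymod i))"
  by (simp add: step_def mod_simps)

text \<open>Adding a pseudo-assignment of odd jump that vanishes on a set of edges relocates the
  violated ring equation without any change on that set.\<close>

lemma pseudo_xor:
  "pseudo (\<lambda>i a. B i a \<noteq> B' i a) (\<lambda>g. c g \<noteq> c' g) e = (pseudo B c e \<noteq> pseudo B' c' e)"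
  by (cases e) auto

lemma odd_jump_single: "g < k \<Longrightarrow> odd_jump (\<lambda>h. h = g)"
proof -
  assume "g < k"
  then have "{h. h < k \<and> h = g} = {g}" by auto
  then show ?thesis by (simp add: odd_jump_def)
qed

lemma odd_card_xor:
  assumes "finite A"
  shows "odd (card {x\<in>A. f x \<noteq> g x}) = (odd (card {x\<in>A. f x}) \<noteq> odd (card {x\<in>A. g x}))"
  using assms
proof (induction A rule: finite_induct)
  case (insert y A)
  have "{x \<in> insert y A. h x} = (if h y then insert y {x\<in>A. h x} else {x\<in>A. h x})" for h by auto
  then show ?case using insert by simp
qed simp

lemma odd_jump_xor: "odd_jump (\<lambda>g. c g \<noteq> c' g) = (odd_jump c \<noteq> odd_jump c')"
  using odd_card_xor[of "{..<k}" c c'] by (simp add: odd_jump_def)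

text \<open>The potentials telescope around the cycle.\<close>

lemma odd_card_pseudo_rungs:
  "odd (card {g. g < k \<and> pseudo B c (rung g t)}) = odd_jump c"
proof -
  define f where "f g = B (g mod k) (t mod laymod (g mod k))" for g
  have eq: "pseudo B c (rung g t) = ((f g \<noteq> f (Suc g)) \<noteq> c g)" if "g < k" for g
    using that by (simp add: pseudo_rung f_def nxt_def)
  have "odd (card {g. g < n \<and> ((f g \<noteq> f (Suc g)) \<noteq> c g)}) =
    ((f 0 \<noteq> f n) \<noteq> odd (card {g. g < n \<and> c g}))" for n
  proof (induction n)
    case (Suc n)
    have "{g. g < Suc n \<and> h g} = (if h n then insert n {g. g < n \<and> h g} else {g. g < n \<and> h g})" for h
      by (auto simp: less_Suc_eq)
    then show ?case using Suc by auto
  qed simp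
  moreover have "f k = f 0" by (simp add: f_def)
  moreover have "{g. g < k \<and> pseudo B c (rung g t)} = {g. g < k \<and> ((f g \<noteq> f (Suc g)) \<noteq> c g)}"
    using eq by blast
  ultimately show ?thesis by (simp add: odd_jump_def)
qed

subsection \<open>Unbalanced edge sets and their locations\<close>

text \<open>\<open>Y\<close> is balanced iff the total jump can be changed without being noticed on \<open>Y\<close>; in terms of the
  compressed cylinder, iff \<open>Y\<close> contains no closed walk that winds around an odd number of times.\<close>

definition unbalanced :: "edge set \<Rightarrow> bool" where
  "unbalanced Y \<longleftrightarrow> (\<forall>B c. odd_jump c \<longrightarrow> (\<exists>e\<in>Y. pseudo B c e))"

definition rungs_of :: "edge set \<Rightarrow> nat \<Rightarrow> int set" where
  "rungs_of Y g = {a. Rung g a \<in> Y}"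

text \<open>Gaps crossed more than once impose nothing. The window of length \<open>slack\<close>
  absorbs the steps that a walk takes within the layers.\<close>

definition locations :: "edge set \<Rightarrow> int set" where
  "locations Y = {l. unbalanced Y \<and> (\<forall>g<k. \<forall>a. rungs_of Y g = {a} \<longrightarrow>
     (\<exists>d\<in>{0..int slack}. [a = l + d] (mod gapmod g)))}"

lemma unbalanced_mono: "\<lbrakk>unbalanced Y; Y \<subseteq> Y'\<rbrakk> \<Longrightarrow> unbalanced Y'"
  unfolding unbalanced_def by blast

text \<open>A gap free of rungs of \<open>Y\<close> could carry the whole jump, with all potentials
  zero.\<close>

lemma unbalanced_rungs_nonempty:
  assumes "unbalanced Y" "g < k"
  shows "rungs_of Y g \<noteq> {}"
proof
  assume "rungs_of Y g = {}"
  then have "\<not> pseudo (\<lambda>_ _. False) (\<lambda>h. h = g) e" if "e \<in> Y" for e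
    using that by (cases e) (auto simp: rungs_of_def)
  then show False using assms odd_jump_single unfolding unbalanced_def by blast
qed

text \<open>All gaps are already crossed by \<open>Y\<close>, so further edges can only remove
  single crossings, and with them constraints.\<close>

lemma locations_mono:
  assumes "Y \<subseteq> Y'"
  shows "locations Y \<subseteq> locations Y'"
proof
  fix l assume l: "l \<in> locations Y"
  then have unb: "unbalanced Y" by (simp add: locations_def)
  have "rungs_of Y g = {a}" if "rungs_of Y' g = {a}" "g < k" for g a
    using unbalanced_rungs_nonempty[OF unb that(2)] that(1) assms by (auto simp: rungs_of_def)
  then show "l \<in> locations Y'"
    using l unbalanced_mono[OF unb assms] by (auto simp: locations_def)
qed

lemma arc_subset: "arc j \<subseteq> {..<k}"
  using k_pos by (auto simp: arc_def)

lemma inj_on_cyclic_shift: "inj_on (\<lambda>x. (j + x) mod k) {..<k}"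
proof (rule inj_onI)
  fix x y assume xy: "x \<in> {..<k}" "y \<in> {..<k}" "(j + x) mod k = (j + y) mod k"
  from xy(3) have "[j + x = j + y] (mod k)" unfolding cong_def .
  then have "[x = y] (mod k)" by (simp add: cong_add_lcancel_nat)
  then show "x = y" using xy by (simp add: cong_def)
qed

lemma card_arc: "card (arc j) = R"
  unfolding arc_def using R_less inj_on_subset[OF inj_on_cyclic_shift, of "{..<R}" j]
  by (subst card_image) auto

lemma card_rungs_le:
  assumes "finite Y"
  shows "(\<Sum>g<k. card (rungs_of Y g)) \<le> card Y" "finite (rungs_of Y g)"
proof -
  have sub: "Rung g ` rungs_of Y g \<subseteq> Y" for g by (auto simp: rungs_of_def)
  then have fin: "finite (rungs_of Y g)" for g
    using assms by (meson finite_imageD finite_subset inj_onI edge.inject(1))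
  then show "finite (rungs_of Y g)" .
  have "(\<Sum>g<k. card (rungs_of Y g)) = (\<Sum>g<k. card (Rung g ` rungs_of Y g))"
    by (intro sum.cong refl card_image[symmetric]) (auto simp: inj_on_def)
  also have "\<dots> = card (\<Union>g<k. Rung g ` rungs_of Y g)"
    using fin by (intro card_UN_disjoint[symmetric]) auto
  also have "\<dots> \<le> card Y" using assms sub by (intro card_mono) auto
  finally show "(\<Sum>g<k. card (rungs_of Y g)) \<le> card Y" .
qed

text \<open>Every gap takes one edge; a second one in each of the \<open>R\<close> gaps of an arc
  would add up to \<open>k + R = slack + 1\<close>.\<close>

lemma single_rung_in_arc:
  assumes unb: "unbalanced Y" and fin: "finite Y" and card: "card Y \<le> slack" and j: "j < k"
  shows "\<exists>g\<in>arc j. \<exists>a. rungs_of Y g = {a}"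
proof (rule ccontr)
  assume none: "\<not> ?thesis"
  have ge: "1 + (if g \<in> arc j then 1 else 0) \<le> card (rungs_of Y g)" if "g < k" for g
  proof -
    have "card (rungs_of Y g) \<noteq> 0"
      using unbalanced_rungs_nonempty[OF unb that] card_rungs_le(2)[OF fin] by simp
    moreover have "card (rungs_of Y g) \<noteq> 1" if "g \<in> arc j"
      using none that by (auto simp: card_1_singleton_iff)
    ultimately show ?thesis by (auto split: if_splits)
  qed
  have "(\<Sum>g<k. if g \<in> arc j then 1 else (0::nat)) = card ({..<k} \<inter> arc j)"
    by (simp add: sum.If_cases)
  then have "k + R = (\<Sum>g<k. 1 + (if g \<in> arc j then 1 else 0))"
    unfolding sum.distrib using card_arc[of j] by (simp add: Int_absorb1[OF arc_subset])
  also have "\<dots> \<le> (\<Sum>g<k. card (rungs_of Y g))" using ge by (intro sum_mono) auto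
  also have "\<dots> \<le> card Y" by (rule card_rungs_le(1)[OF fin])
  finally show False using card R_pos by (simp add: slack_def)
qed

subsection \<open>Existence of a location\<close>

text \<open>The number of consecutive steps of \<open>Y\<close> (modulo \<open>P\<close>, in any layer) just below position \<open>n\<close>.
  The quantity \<open>n - run Y n\<close> is invariant under moving along an edge of \<open>Y\<close>.\<close>

definition step_residues :: "edge set \<Rightarrow> int set" where
  "step_residues Y = {a mod P |i a. Step i a \<in> Y}"

definition run :: "edge set \<Rightarrow> int \<Rightarrow> nat" where
  "run Y n = (LEAST s. (n - int s - 1) mod P \<notin> step_residues Y)"

text \<open>Pigeonhole: the \<open>slack + 1\<close> positions below \<open>n\<close> are distinct
  modulo \<open>P\<close>, and \<open>Y\<close> is too small to supply a step at each.\<close>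

lemma run_bound:
  assumes "finite Y" "card Y \<le> slack"
  shows "(n - int (run Y n) - 1) mod P \<notin> step_residues Y" "run Y n \<le> slack"
proof -
  have "\<exists>s\<le>slack. (n - int s - 1) mod P \<notin> step_residues Y"
  proof (rule ccontr)
    assume "\<not> ?thesis"
    then have sub: "(\<lambda>s. (n - int s - 1) mod P) ` {..slack} \<subseteq> step_residues Y" by auto
    have "inj_on (\<lambda>s. (n - int s - 1) mod P) {..slack}"
    proof (rule inj_onI)
      fix s t assume st: "s \<in> {..slack}" "t \<in> {..slack}"
        "(n - int s - 1) mod P = (n - int t - 1) mod P"
      then have "P dvd (n - int s - 1) - (n - int t - 1)" by (simp add: mod_eq_dvd_iff)
      then have "P dvd int t - int s" by (simp add: algebra_simps)
      moreover have "\<bar>int t - int s\<bar> < P" using st P_ge R_pos by (auto simp: slack_def)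
      ultimately show "s = t" using zdvd_imp_le[of P "\<bar>int t - int s\<bar>"] by fastforce
    qed
    moreover have fin: "finite (step_residues Y)" and "card (step_residues Y) \<le> card Y"
    proof -
      have eq: "step_residues Y \<subseteq> (\<lambda>e. case e of Step i a \<Rightarrow> a mod P | Rung g a \<Rightarrow> 0) ` Y"
        by (force simp: step_residues_def)
      then show "finite (step_residues Y)" using assms(1) finite_surj by blast
      show "card (step_residues Y) \<le> card Y" using surj_card_le[OF assms(1) eq] .
    qed
    ultimately have "card {..slack} \<le> card Y"
      using card_inj_on_le[OF _ sub fin] by linarith
    then show False using assms(2) by simp
  qed
  then obtain s where s: "s \<le> slack" "(n - int s - 1) mod P \<notin> step_residues Y" by blast
  show "(n - int (run Y n) - 1) mod P \<notin> step_residues Y"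
    unfolding run_def by (rule LeastI) (rule s(2))
  have "run Y n \<le> s" unfolding run_def by (rule Least_le) (rule s(2))
  then show "run Y n \<le> slack" using s by simp
qed

lemma run_cong:
  assumes "[n = m] (mod P)"
  shows "run Y n = run Y m"
proof -
  have "[n - int s - 1 = m - int s - 1] (mod P)" for s
    by (intro cong_diff assms cong_refl)
  then have "(n - int s - 1) mod P = (m - int s - 1) mod P" for s unfolding cong_def .
  then show ?thesis unfolding run_def by presburger
qed

lemma run_mod: "P dvd q \<Longrightarrow> run Y (n mod q) = run Y n"
  by (intro run_cong) (simp add: cong_def mod_mod_cancel)

lemma run_Suc:
  assumes fin: "finite Y" "card Y \<le> slack" and n: "n mod P \<in> step_residues Y"
  shows "run Y (n + 1) = Suc (run Y n)"
proof -
  have "run Y (n + 1) = (LEAST s. (n + 1 - int s - 1) mod P \<notin> step_residues Y)"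
    by (simp add: run_def)
  also have "\<dots> = Suc (LEAST s. (n + 1 - int (Suc s) - 1) mod P \<notin> step_residues Y)"
    by (rule Least_Suc[where n = "run Y (n + 1)"]) (use run_bound(1)[OF fin, of "n + 1"] n in auto)
  also have "(\<lambda>s. (n + 1 - int (Suc s) - 1) mod P \<notin> step_residues Y) =
      (\<lambda>s. (n - int s - 1) mod P \<notin> step_residues Y)"
    by (simp add: algebra_simps)
  finally show ?thesis by (simp add: run_def)
qed

text \<open>Otherwise the indicator of the points of \<open>S\<close> that carry the invariant of the edge in gap \<open>g\<close>
  would be a potential witnessing that \<open>Y\<close> is balanced.\<close>

lemma single_rungs_agree:
  assumes unb: "unbalanced Y" and fin: "finite Y" "card Y \<le> slack" and Y: "Y \<subseteq> edges"
    and g: "g < k" "rungs_of Y g = {a}" and h: "h < k" "rungs_of Y h = {a'}"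
    and S: "g \<notin> S" "nxt g \<in> S" "h \<in> S" "nxt h \<notin> S"
      "\<And>f. \<lbrakk>f < k; f \<noteq> g; f \<noteq> h\<rbrakk> \<Longrightarrow> f \<in> S \<longleftrightarrow> nxt f \<in> S"
    and q: "P dvd q" "\<And>i. i \<in> S \<Longrightarrow> q dvd laymod i"
  shows "[a' - int (run Y a') = a - int (run Y a)] (mod q)"
proof (rule ccontr)
  assume neq: "\<not> ?thesis"
  define I where "I v \<longleftrightarrow> [v - int (run Y v) = a - int (run Y a)] (mod q)" for v
  have I_mod: "I (v mod laymod i) \<longleftrightarrow> I v" if "i \<in> S" for i v
  proof -
    have "run Y (v mod laymod i) = run Y v" by (intro run_mod P_dvd_laymod)
    moreover have "[v mod laymod i = v] (mod q)"
      unfolding cong_def using q(2)[OF that] by (rule mod_mod_cancel)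
    then have "[v mod laymod i - int (run Y v) = v - int (run Y v)] (mod q)"
      by (intro cong_diff cong_refl)
    ultimately show ?thesis unfolding I_def cong_def by presburger
  qed
  define B where "B i v \<longleftrightarrow> i \<in> S \<and> I v" for i v
  have B_mod: "B i (v mod laymod i) \<longleftrightarrow> i \<in> S \<and> I v" for i v using I_mod by (auto simp: B_def)
  \<comment> \<open>The jump in gap \<open>g\<close> compensates for entering \<open>S\<close> at
    potential \<open>True\<close>, while \<open>S\<close> is left through gap \<open>h\<close> at
    potential \<open>False\<close>. Steps preserve the invariant, and all other rungs stay inside or
    outside \<open>S\<close>.\<close>
  have "\<not> pseudo B (\<lambda>f. f = g) e" if e: "e \<in> Y" for e
  proof (cases e)
    case (Rung f v)
    then have f: "f < k" using Y e by (auto simp: edges_def)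
    consider "f = g" "v = a" | "f = h" "v = a'" "f \<noteq> g" | "f \<noteq> g" "f \<noteq> h"
      using g(2) h(2) e Rung by (auto simp: rungs_of_def)
    then show ?thesis
    proof cases
      case 1
      then show ?thesis using S Rung by (simp add: B_mod I_def)
    next
      case 2
      then show ?thesis using S Rung neq by (simp add: B_mod I_def)
    next
      case 3
      then show ?thesis using S(5)[OF f 3] Rung by (simp add: B_mod)
    qed
  next
    case (Step i v)
    then have "v mod P \<in> step_residues Y" using e by (auto simp: step_residues_def)
    then have "run Y (v + 1) = Suc (run Y v)" by (rule run_Suc[OF fin])
    then have "I (v + 1) = I v" by (simp add: I_def)
    then show ?thesis using Step by (simp add: B_mod)
  qed
  then show False using unb odd_jump_single[OF g(1)] unfolding unbalanced_def by blast
qed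

text \<open>\<open>P\<close> divides every layer modulus, so the layers between the two gaps may be
  arbitrary. Ordering the gaps gives an interval of layers that does not wrap around.\<close>

lemma single_rungs_agree_mod_P:
  assumes unb: "unbalanced Y" and fin: "finite Y" "card Y \<le> slack" and Y: "Y \<subseteq> edges"
    and g: "g < k" "rungs_of Y g = {a}" and h: "h < k" "rungs_of Y h = {a'}"
  shows "[a' - int (run Y a') = a - int (run Y a)] (mod P)"
proof -
  have less: "[a' - int (run Y a') = a - int (run Y a)] (mod P)"
    if "g < h" "h < k" "rungs_of Y g = {a}" "rungs_of Y h = {a'}" for g h a a'
  proof (rule single_rungs_agree[OF unb fin Y])
    show "f \<in> {g<..h} \<longleftrightarrow> nxt f \<in> {g<..h}" if "f < k" "f \<noteq> g" "f \<noteq> h" for f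
      using that \<open>g < h\<close> \<open>h < k\<close> by (cases "f + 1 = k") (auto simp: nxt_def)
    show "nxt h \<notin> {g<..h}" using that by (cases "h + 1 = k") (auto simp: nxt_def)
  qed (use that P_dvd_laymod in \<open>auto simp: nxt_def\<close>)
  consider "g < h" | "h < g" | "g = h" by linarith
  then show ?thesis
  proof cases
    case 1 then show ?thesis using less g h by blast
  next
    case 2 then show ?thesis using less g h by (blast intro: cong_sym)
  next
    case 3 then show ?thesis using g h by simp
  qed
qed

text \<open>A layer between two gaps of the arc has both of its neighbouring gaps in the arc, so
  \<open>P * p j\<close> divides its modulus; this is why the invariant survives modulo
  \<open>p j\<close> as well. The shift \<open>s\<close> moves the start of the arc to
  \<open>0\<close>, so that \<open>R < k\<close> prevents wrapping.\<close>

lemma single_rungs_agree_in_arc: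
  assumes unb: "unbalanced Y" and fin: "finite Y" "card Y \<le> slack" and Y: "Y \<subseteq> edges" and j: "j < k"
    and g: "g \<in> arc j" "rungs_of Y g = {a}" and h: "h \<in> arc j" "rungs_of Y h = {a'}"
  shows "[a' - int (run Y a') = a - int (run Y a)] (mod P * p j)"
proof -
  define s where "s x = (j + x) mod k" for x
  have s_less: "s x < k" for x using k_pos by (simp add: s_def)
  have s_inj: "s x = s y \<longleftrightarrow> x = y" if "x < k" "y < k" for x y
    using inj_on_eq_iff[OF inj_on_cyclic_shift[of j], of x y] that by (simp add: s_def)
  have nxt_s: "nxt (s x) = s (x + 1)" for x by (simp add: s_def nxt_def mod_simps)
  have surj: "\<exists>x<k. f = s x" if "f < k" for f
  proof -
    have "s ` {..<k} = {..<k}"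
      using s_less inj_on_cyclic_shift[of j]
      by (intro card_subset_eq) (auto simp: s_def card_image)
    then show ?thesis using that by blast
  qed
  have s_arc: "s x \<in> arc j" if "x < R" for x using that by (auto simp: arc_def s_def)
  have less: "[a' - int (run Y a') = a - int (run Y a)] (mod P * p j)"
    if xy: "x < y" "y < R" and sx: "rungs_of Y (s x) = {a}" and sy: "rungs_of Y (s y) = {a'}"
    for x y a a'
  proof (rule single_rungs_agree[OF unb fin Y s_less sx s_less sy])
    have in_S: "s z \<in> s ` {x<..y} \<longleftrightarrow> x < z \<and> z \<le> y" if "z < k" for z
      using that xy R_less s_inj by (auto simp: image_iff)
    show "s x \<notin> s ` {x<..y}" "s y \<in> s ` {x<..y}" using in_S xy R_less by auto
    show "nxt (s x) \<in> s ` {x<..y}" using xy by (auto simp: nxt_s)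
    have nxt_in_S: "nxt (s z) \<in> s ` {x<..y} \<longleftrightarrow> x \<le> z \<and> z < y" if "z < k" for z
    proof (cases "z + 1 = k")
      case True
      then have "s (z + 1) = s 0" by (simp add: s_def)
      then have "nxt (s z) = s 0" by (simp add: nxt_s)
      then show ?thesis using True in_S[of 0] xy R_less by auto
    next
      case False
      then show ?thesis using that in_S[of "z + 1"] by (simp add: nxt_s) linarith
    qed
    show "nxt (s y) \<notin> s ` {x<..y}" using nxt_in_S[of y] xy R_less by auto
    fix f assume f: "f < k" "f \<noteq> s x" "f \<noteq> s y"
    then obtain z where "z < k" "f = s z" using surj by blast
    then show "f \<in> s ` {x<..y} \<longleftrightarrow> nxt f \<in> s ` {x<..y}"
      using f in_S nxt_in_S by (metis le_neq_implies_less less_imp_le_nat)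
  next
    fix i assume "i \<in> s ` {x<..y}"
    then obtain z where z: "x < z" "z \<le> y" "i = s z" by auto
    then have "i = nxt (s (z - 1))" by (simp add: nxt_s)
    then have "prv i = s (z - 1)" using s_less by simp
    then have "i \<in> arc j" "prv i \<in> arc j" using s_arc z xy by auto
    then show "P * p j dvd laymod i" using Pp_dvd_gapmod[OF j] by (simp add: laymod_def)
  qed simp
  obtain x y where xy: "x < R" "g = s x" "y < R" "h = s y"
    using g h by (auto simp: arc_def s_def)
  consider "x < y" | "y < x" | "x = y" by linarith
  then show ?thesis
  proof cases
    case 1 then show ?thesis using less xy g h by blast
  next
    case 2 then show ?thesis using less xy g h by (blast intro: cong_sym)
  next
    case 3 then show ?thesis using g h xy by simp
  qed
qed

lemma cong_gapmod:
  assumes "[x = y] (mod P)" "\<And>j. \<lbrakk>j < k; g \<in> arc j\<rbrakk> \<Longrightarrow> [x = y] (mod p j)"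
  shows "[x = y] (mod gapmod g)"
  unfolding gapmod_def
proof (rule coprime_cong_mult)
  show "[x = y] (mod (\<Prod>j | j < k \<and> g \<in> arc j. p j))"
    using assms coprime_p by (intro cong_cong_prod_coprime) auto
  show "coprime P (\<Prod>j | j < k \<and> g \<in> arc j. p j)"
    using coprime_P by (intro prod_coprime_right) auto
qed (rule assms)

text \<open>The residues glued together are those of the invariants \<open>a - run Y a\<close>,
  which agree wherever two single rungs can be compared. Each single rung then exceeds the location
  by \<open>run Y a\<close>, which is at most \<open>slack\<close>.\<close>

lemma locations_nonempty:
  assumes unb: "unbalanced Y" and fin: "finite Y" "card Y \<le> slack" and Y: "Y \<subseteq> edges"
  shows "locations Y \<noteq> {}"
proof -
  have "\<forall>j<k. \<exists>g a. g \<in> arc j \<and> rungs_of Y g = {a}"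
    using single_rung_in_arc[OF unb fin] by blast
  then obtain \<gamma> \<alpha> where \<gamma>: "\<And>j. j < k \<Longrightarrow> \<gamma> j \<in> arc j \<and> rungs_of Y (\<gamma> j) = {\<alpha> j}" by metis
  define r where "r j = \<alpha> j - int (run Y (\<alpha> j))" for j
  have "\<exists>l. \<forall>j\<in>{..<k}. [l = r j] (mod p j)"
    using coprime_p by (intro chinese_remainder_int) auto
  then obtain l0 where l0: "\<And>j. j < k \<Longrightarrow> [l0 = r j] (mod p j)" by auto
  have "coprime P (\<Prod>j<k. p j)" using coprime_P by (intro prod_coprime_right) auto
  then obtain l where l: "[l = r 0] (mod P)" "[l = l0] (mod (\<Prod>j<k. p j))"
    using binary_chinese_remainder_int by blast
  have l_p: "[l = r j] (mod p j)" if "j < k" for j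
  proof -
    have "p j dvd (\<Prod>j<k. p j)" using that by (intro dvd_prodI) auto
    then show ?thesis using l(2) l0[OF that] by (meson cong_dvd_modulus cong_trans)
  qed
  have \<gamma>_less: "\<gamma> j < k" if "j < k" for j using \<gamma>[OF that] arc_subset by blast
  have "\<exists>d\<in>{0..int slack}. [a = l + d] (mod gapmod g)" if g: "g < k" "rungs_of Y g = {a}" for g a
  proof
    show "int (run Y a) \<in> {0..int slack}" using run_bound(2)[OF fin] by simp
    have "[a - int (run Y a) = l] (mod gapmod g)"
    proof (rule cong_gapmod)
      have "[a - int (run Y a) = r 0] (mod P)"
        unfolding r_def using \<gamma>[OF k_pos] \<gamma>_less[OF k_pos] g
        by (intro single_rungs_agree_mod_P[OF unb fin Y, of "\<gamma> 0" _ g]) auto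
      then show "[a - int (run Y a) = l] (mod P)" using l(1) by (meson cong_trans cong_sym)
      fix j assume j: "j < k" "g \<in> arc j"
      have "[a - int (run Y a) = r j] (mod P * p j)"
        unfolding r_def using \<gamma>[OF j(1)] g(2) j
        by (intro single_rungs_agree_in_arc[OF unb fin Y j(1), of "\<gamma> j" _ g]) auto
      then have "[a - int (run Y a) = r j] (mod p j)" by (rule cong_dvd_modulus) simp
      then show "[a - int (run Y a) = l] (mod p j)" using l_p[OF j(1)] by (meson cong_trans cong_sym)
    qed
    then have "[a - int (run Y a) + int (run Y a) = l + int (run Y a)] (mod gapmod g)"
      by (intro cong_add cong_refl)
    then show "[a = l + int (run Y a)] (mod gapmod g)" by simp
  qed
  then have "l \<in> locations Y" using unb by (simp add: locations_def)
  then show ?thesis by blast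
qed

text \<open>Every single rung yields a displacement valid modulo its own gap modulus. All of them
  agree modulo \<open>P\<close> and are small, hence are one and the same integer, valid modulo
  every \<open>p j\<close> and so modulo \<open>period\<close>.\<close>

lemma locations_close:
  assumes fin: "finite Y" "card Y \<le> slack" and l: "l \<in> locations Y" "l' \<in> locations Y"
  shows "\<exists>e. \<bar>e\<bar> \<le> int slack \<and> [l' = l + e] (mod period)"
proof -
  have unb: "unbalanced Y" using l by (simp add: locations_def)
  have diff: "\<exists>e. \<bar>e\<bar> \<le> int slack \<and> [l' = l + e] (mod gapmod g)"
    if "g < k" "rungs_of Y g = {a}" for g a
  proof -
    have "\<exists>d\<in>{0..int slack}. [a = m + d] (mod gapmod g)" if "m \<in> locations Y" for m
      using that \<open>g < k\<close> \<open>rungs_of Y g = {a}\<close> by (simp add: locations_def)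
    then obtain d d' where d: "d \<in> {0..int slack}" "[a = l + d] (mod gapmod g)"
      "d' \<in> {0..int slack}" "[a = l' + d'] (mod gapmod g)"
      using l by metis
    then have "[l' + d' = l + d] (mod gapmod g)" by (meson cong_trans cong_sym)
    then have "[l' + d' - d' = l + d - d'] (mod gapmod g)" by (intro cong_diff cong_refl)
    then show ?thesis using d by (intro exI[of _ "d - d'"]) (auto simp: algebra_simps)
  qed
  obtain g0 a0 where g0: "g0 \<in> arc 0" "rungs_of Y g0 = {a0}"
    using single_rung_in_arc[OF unb fin k_pos] by blast
  then have "g0 < k" using arc_subset by blast
  then obtain e where e: "\<bar>e\<bar> \<le> int slack" "[l' = l + e] (mod gapmod g0)" using diff g0 by blast
  have eP: "[l' = l + e] (mod P)" using e(2) P_dvd_gapmod by (rule cong_dvd_modulus)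
  have "[l' = l + e] (mod p j)" if j: "j < k" for j
  proof -
    obtain g a where g: "g \<in> arc j" "rungs_of Y g = {a}"
      using single_rung_in_arc[OF unb fin j] by blast
    then have "g < k" using arc_subset by blast
    then obtain e' where e': "\<bar>e'\<bar> \<le> int slack" "[l' = l + e'] (mod gapmod g)" using diff g by blast
    have "[l' = l + e'] (mod P)" using e'(2) P_dvd_gapmod by (rule cong_dvd_modulus)
    then have "[l + e = l + e'] (mod P)" using eP by (meson cong_trans cong_sym)
    then have "P dvd e - e'" by (simp add: cong_iff_dvd_diff)
    moreover have "\<bar>e - e'\<bar> < P" using e(1) e'(1) P_ge R_pos by (auto simp: slack_def)
    ultimately have "e = e'" using zdvd_imp_le[of P "\<bar>e - e'\<bar>"] by fastforce
    moreover have "p j dvd gapmod g" using Pp_dvd_gapmod[OF j g(1)] by (metis dvd_mult_right)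
    ultimately show ?thesis using e'(2) by (blast intro: cong_dvd_modulus)
  qed
  then have "[l' = l + e] (mod (\<Prod>j<k. p j))"
    using coprime_p by (intro cong_cong_prod_coprime) auto
  moreover have "coprime P (\<Prod>j<k. p j)" using coprime_P by (intro prod_coprime_right) auto
  ultimately have "[l' = l + e] (mod period)"
    unfolding period_def using eP by (intro coprime_cong_mult)
  then show ?thesis using e(1) by blast
qed

end

subsection \<open>Encoding parity systems\<close>

fun edge_code :: "edge \<Rightarrow> nat" where
  "edge_code (Rung g a) = 2 * prod_encode (g, int_encode a)"
| "edge_code (Step i a) = Suc (2 * prod_encode (i, int_encode a))"

definition copy :: "edge \<Rightarrow> nat \<Rightarrow> nat" where
  "copy e i = 2 * prod_encode (edge_code e, i)"

definition pad :: "nat \<Rightarrow> nat" where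
  "pad j = Suc (2 * j)"

lemma edge_code_inject [simp]: "edge_code e = edge_code e' \<longleftrightarrow> e = e'"
proof
  assume eq: "edge_code e = edge_code e'"
  have "2 * m \<noteq> Suc (2 * n)" "Suc (2 * n) \<noteq> 2 * m" for m n by presburger+
  then show "e = e'" using eq by (cases e; cases e') (auto dest!: int_encode_eq[THEN iffD1])
qed simp

lemma copy_inject [simp]: "copy e i = copy e' i' \<longleftrightarrow> e = e' \<and> i = i'"
  by (auto simp: copy_def)

lemma copy_neq_pad [simp]: "copy e i \<noteq> pad j"
  by (simp add: copy_def pad_def double_not_eq_Suc_double)

definition copies :: "nat \<Rightarrow> edge set \<Rightarrow> nat set" where
  "copies b Y = {copy e i |e i. e \<in> Y \<and> i < b}"

definition edge_value :: "nat \<Rightarrow> (nat \<Rightarrow> bool) \<Rightarrow> edge \<Rightarrow> bool" where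
  "edge_value b \<alpha> e \<longleftrightarrow> odd (card {i. i < b \<and> \<alpha> (copy e i)})"

text \<open>On lists, adding equations is concatenation and an edge occurring twice cancels.\<close>

definition parity :: "('e \<Rightarrow> bool) \<Rightarrow> 'e list \<Rightarrow> bool" where
  "parity \<beta> es \<longleftrightarrow> odd (length (filter \<beta> es))"

text \<open>The clause over all of \<open>V\<close> that \<open>\<alpha>\<close> falsifies:
  \<open>Neg\<close> literals mark the variables that \<open>\<alpha>\<close> makes true.\<close>

definition full_clause :: "'v set \<Rightarrow> ('v \<Rightarrow> bool) \<Rightarrow> 'v clause" where
  "full_clause V \<alpha> = (\<lambda>v. if \<alpha> v then Neg v else Pos v) ` V"

fun encode :: "nat \<Rightarrow> edge list \<times> bool \<Rightarrow> nat cnf" where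
  "encode b (es, r) = {full_clause (copies b (set es)) \<alpha> |\<alpha>. parity (edge_value b \<alpha>) es \<noteq> r}"

lemma parity_Nil [simp]: "parity \<beta> [] = False"
  and parity_Cons [simp]: "parity \<beta> (e # es) = (\<beta> e \<noteq> parity \<beta> es)"
  and parity_append [simp]: "parity \<beta> (es @ es') = (parity \<beta> es \<noteq> parity \<beta> es')"
  by (auto simp: parity_def)

lemma parity_cong: "(\<And>e. e \<in> set es \<Longrightarrow> \<beta> e = \<gamma> e) \<Longrightarrow> parity \<beta> es = parity \<gamma> es"
  by (induction es) auto

lemma parity_map_upt: "parity \<beta> (map f [0..<n]) = odd (card {i. i < n \<and> \<beta> (f i)})"
proof -
  have "{i. i < length (map f [0..<n]) \<and> \<beta> (map f [0..<n] ! i)} = {i. i < n \<and> \<beta> (f i)}" by auto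
  then show ?thesis unfolding parity_def length_filter_conv_card by simp
qed

lemma edge_value_cong:
  assumes "\<And>i. i < b \<Longrightarrow> \<alpha> (copy e i) = \<beta> (copy e i)"
  shows "edge_value b \<alpha> e = edge_value b \<beta> e"
proof -
  have "{i. i < b \<and> \<alpha> (copy e i)} = {i. i < b \<and> \<beta> (copy e i)}" using assms by blast
  then show ?thesis by (simp add: edge_value_def)
qed

lemma copies_eq_image: "copies b Y = (\<lambda>(e, i). copy e i) ` (Y \<times> {..<b})"
  by (auto simp: copies_def)

lemma finite_copies: "finite Y \<Longrightarrow> finite (copies b Y)"
  and card_copies_le: "finite Y \<Longrightarrow> card (copies b Y) \<le> b * card Y"
  unfolding copies_eq_image using card_image_le[of "Y \<times> {..<b}" "\<lambda>(e, i). copy e i"]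
  by (simp_all add: card_cartesian_product mult.commute)

lemma var_of_full_clause: "var_of ` full_clause V \<alpha> = V"
proof -
  have "var_of (if \<alpha> v then Neg v else Pos v) = v" for v by simp
  then show ?thesis unfolding full_clause_def image_image by simp
qed

lemma Neg_in_full_clause: "v \<in> V \<Longrightarrow> Neg v \<in> full_clause V \<alpha> \<longleftrightarrow> \<alpha> v"
  by (auto simp: full_clause_def)

lemma falsified_full_clause: "falsified \<alpha> (full_clause V \<alpha>)"
  by (auto simp: falsified_def full_clause_def)

context cylinder
begin

definition half :: int where "half = period div 2"

text \<open>The boundary of one face of the cylinder: both rungs cross the same gap, so the jump
  cancels together with the potentials.\<close>

definition local_eq :: "nat \<Rightarrow> int \<Rightarrow> edge list" where
  "local_eq g a = [rung g a, rung g (a + 1), step g a, step (nxt g) a]"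

definition ring :: "int \<Rightarrow> edge list" where
  "ring t = map (\<lambda>g. rung g t) [0..<k]"

definition system :: "(edge list \<times> bool) set" where
  "system = {(local_eq g a, False) |g a. g < k \<and> a \<in> {0..<gapmod g}} \<union> {(ring 0, True), (ring half, False)}"

definition base_cnf :: "nat \<Rightarrow> nat cnf" where
  "base_cnf b = (\<Union>s\<in>system. encode b s)"

definition formula :: "nat \<Rightarrow> nat \<Rightarrow> nat cnf" where
  "formula b n = base_cnf b \<union> (\<lambda>j. {Pos (pad j)}) ` {..<n}"

lemma system_edges: "(es, r) \<in> system \<Longrightarrow> set es \<subseteq> edges"
  by (auto simp: system_def local_eq_def ring_def)

lemma parity_local_eq: "g < k \<Longrightarrow> parity (pseudo B c) (local_eq g a) = False"
proof -
  have cancel: "(((x \<noteq> y) \<noteq> z) \<noteq> (((x' \<noteq> y') \<noteq> z) \<noteq> ((x \<noteq> x') \<noteq> ((y \<noteq> y') \<noteq> False)))) = False"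
    for x y z x' y' :: bool
    by (cases x; cases y; cases z; cases x'; cases y') simp_all
  show "g < k \<Longrightarrow> ?thesis"
    unfolding local_eq_def parity_Cons parity_Nil pseudo_step
    by (simp only: pseudo_rung cancel)
qed

lemma parity_ring: "parity (pseudo B c) (ring t) = odd_jump c"
  unfolding ring_def parity_map_upt by (rule odd_card_pseudo_rungs)

lemma ring_location:
  assumes "set (ring t) \<subseteq> Y"
  shows "t \<in> locations Y"
proof -
  have Y: "rung g t \<in> Y" if "g < k" for g using assms that by (auto simp: ring_def)
  have "unbalanced Y"
    unfolding unbalanced_def
  proof (intro allI impI)
    fix B c assume "odd_jump c"
    then have "{g. g < k \<and> pseudo B c (rung g t)} \<noteq> {}"
      using odd_card_pseudo_rungs[of B c t] by (metis card.empty even_zero)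
    then show "\<exists>e\<in>Y. pseudo B c e" using Y by blast
  qed
  moreover have "[a = t + 0] (mod gapmod g)" if "g < k" "rungs_of Y g = {a}" for g a
  proof -
    have "t mod gapmod g \<in> rungs_of Y g" using Y[OF that(1)] by (simp add: rungs_of_def rung_def)
    then have "a = t mod gapmod g" using that(2) by simp
    then show ?thesis by (simp add: cong_def)
  qed
  ultimately show ?thesis
    unfolding locations_def by (intro CollectI conjI allI impI bexI[of _ 0]) auto
qed

subsection \<open>The lower bound\<close>

definition mentioned :: "nat \<Rightarrow> nat clause \<Rightarrow> edge \<Rightarrow> nat set" where
  "mentioned b C e = {i. i < b \<and> copy e i \<in> var_of ` C}"

text \<open>The threshold lies one copy before completion: while a copy is missing, the clause does
  not determine the value of the edge.\<close>

definition touched :: "nat \<Rightarrow> nat clause \<Rightarrow> edge set" where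
  "touched b C = {e\<in>edges. b - 1 \<le> card (mentioned b C e)}"

definition complete :: "nat \<Rightarrow> nat clause \<Rightarrow> edge set" where
  "complete b C = {e\<in>edges. mentioned b C e = {..<b}}"

definition far :: "int \<Rightarrow> int \<Rightarrow> int \<Rightarrow> bool" where
  "far D l x \<longleftrightarrow> (\<forall>e. \<bar>e\<bar> < D \<longrightarrow> \<not> [l = x + e] (mod period))"

text \<open>The ring equation that a pseudo-assignment with jump \<open>c\<close> violates sits at this position.\<close>

definition defect :: "(nat \<Rightarrow> bool) \<Rightarrow> int" where
  "defect c = (if odd_jump c then half else 0)"

text \<open>The counter \<open>d\<close> measures the distance to the defect in units of
  \<open>slack\<close>; without locations this condition is vacuous. The ban on positive literals
  outside the copies excludes the unit clauses on padding variables.\<close>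

definition good :: "nat \<Rightarrow> nat clause \<Rightarrow> nat \<Rightarrow> bool" where
  "good b C d \<longleftrightarrow> (\<forall>x. Pos x \<in> C \<longrightarrow> x \<in> copies b edges) \<and>
     (\<exists>B c. (\<forall>e\<in>complete b C. pseudo B c e = edge_value b (\<lambda>v. Neg v \<in> C) e) \<and>
       (\<forall>l\<in>locations (touched b C). far (int (slack * d)) l (defect c)))"

lemma finite_mentioned [simp]: "finite (mentioned b C e)"
  by (simp add: mentioned_def)

lemma finite_touched: "finite (touched b C)"
  using finite_edges by (simp add: touched_def)

lemma complete_subset_touched: "complete b C \<subseteq> touched b C"
proof
  fix e assume e: "e \<in> complete b C"
  then have "mentioned b C e = {..<b}" by (simp add: complete_def)
  then have "card (mentioned b C e) = b" by simp
  then show "e \<in> touched b C" using e by (simp add: complete_def touched_def)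
qed

lemma card_touched_le:
  assumes "finite C"
  shows "(b - 1) * card (touched b C) \<le> card C"
proof -
  have "(b - 1) * card (touched b C) = (\<Sum>e\<in>touched b C. b - 1)" by simp
  also have "\<dots> \<le> (\<Sum>e\<in>touched b C. card (mentioned b C e))"
    by (intro sum_mono) (simp add: touched_def)
  also have "\<dots> = (\<Sum>e\<in>touched b C. card (copy e ` mentioned b C e))"
    by (intro sum.cong refl card_image[symmetric]) (auto simp: inj_on_def)
  also have "\<dots> = card (\<Union>e\<in>touched b C. copy e ` mentioned b C e)"
    using finite_touched by (intro card_UN_disjoint[symmetric]) auto
  also have "\<dots> \<le> card (var_of ` C)"
    using assms by (intro card_mono) (auto simp: mentioned_def)
  also have "\<dots> \<le> card C" using assms by (rule card_image_le)
  finally show ?thesis .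
qed

text \<open>The strict bound leaves room for the one edge that a resolution step may add.\<close>

lemma card_touched_less:
  assumes "is_clause C" "card C \<le> w" "w < (b - 1) * slack"
  shows "card (touched b C) < slack"
proof -
  have "(b - 1) * card (touched b C) \<le> w"
    using card_touched_le[of C b] assms by (auto simp: is_clause_def)
  then have "(b - 1) * card (touched b C) < (b - 1) * slack" using assms(3) by (rule le_less_trans)
  then show ?thesis by simp
qed

lemma defect_far_apart:
  assumes jump: "odd_jump c \<noteq> odd_jump c'"
    and D: "2 * int (slack * Suc d) \<le> half"
    and l: "\<not> far (int (slack * d)) l (defect c)"
    and l': "\<bar>e\<bar> \<le> int slack" "[l' = l + e] (mod period)"
  shows "far (int (slack * d)) l' (defect c')"
proof (rule ccontr)
  assume "\<not> ?thesis"
  then obtain e2 where e2: "\<bar>e2\<bar> < int (slack * d)" "[l' = defect c' + e2] (mod period)"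
    by (auto simp: far_def)
  obtain e0 where e0: "\<bar>e0\<bar> < int (slack * d)" "[l = defect c + e0] (mod period)"
    using l by (auto simp: far_def)
  define f where "f = e0 + e - e2"
  have "[l + e = defect c + e0 + e] (mod period)" using e0 by (intro cong_add cong_refl)
  then have "[defect c' + e2 = defect c + e0 + e] (mod period)"
    using l'(2) e2(2) by (meson cong_sym cong_trans)
  then have dvd: "period dvd (defect c' - defect c) - f"
    by (simp add: cong_iff_dvd_diff f_def algebra_simps)
  \<comment> \<open>Being near both defects would leave a discrepancy below
    \<open>slack * (2 * d + 1)\<close>, whereas the defects are \<open>half\<close> apart in either
    direction around the cycle.\<close>
  have "\<bar>f\<bar> < half"
    using e0(1) e2(1) l'(1) D by (simp add: f_def algebra_simps)
  moreover have "\<bar>defect c' - defect c\<bar> = half"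
    using jump \<open>\<bar>f\<bar> < half\<close> by (auto simp: defect_def)
  moreover have "2 * half \<le> period" by (simp add: half_def)
  ultimately have "(defect c' - defect c) - f \<noteq> 0" "\<bar>(defect c' - defect c) - f\<bar> < period"
    by linarith+
  then show False using dvd zdvd_imp_le[of period "\<bar>(defect c' - defect c) - f\<bar>"] by simp
qed

text \<open>At most one edge gets touched. If that edge creates the first location, the set touched before
  is balanced, and the defect can be moved to whichever of its two positions is far away.\<close>

lemma good_touch_edge:
  assumes good: "good b E (Suc d)" and D: "2 * int (slack * Suc d) \<le> half"
    and card: "card (touched b E) < slack" and e: "e \<in> edges"
    and tA: "touched b A \<subseteq> insert e (touched b E)" and cA: "complete b A \<subseteq> complete b E"
    and val: "\<And>e'. e' \<in> complete b A \<Longrightarrow>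
      edge_value b (\<lambda>v. Neg v \<in> A) e' = edge_value b (\<lambda>v. Neg v \<in> E) e'"
    and pos: "\<forall>x. Pos x \<in> A \<longrightarrow> x \<in> copies b edges"
  shows "good b A d"
proof -
  obtain B c where Bc: "\<And>e'. e' \<in> complete b E \<Longrightarrow> pseudo B c e' = edge_value b (\<lambda>v. Neg v \<in> E) e'"
    "\<And>l. l \<in> locations (touched b E) \<Longrightarrow> far (int (slack * Suc d)) l (defect c)"
    using good unfolding good_def by blast
  define Y where "Y = insert e (touched b E)"
  have Y: "finite Y" "card Y \<le> slack"
    using finite_touched card card_insert_le_m1[of slack "touched b E" e] by (auto simp: Y_def card_insert_if)
  have sub: "locations (touched b A) \<subseteq> locations Y" "locations (touched b E) \<subseteq> locations Y"
    using tA by (intro locations_mono; auto simp: Y_def)+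
  show ?thesis
  proof (cases "\<forall>l\<in>locations (touched b A). far (int (slack * d)) l (defect c)")
    case True
    then show ?thesis
      unfolding good_def using pos Bc(1) cA val by (intro conjI exI[of _ B] exI[of _ c]) auto
  next
    case False
    then obtain l0 where l0: "l0 \<in> locations (touched b A)" "\<not> far (int (slack * d)) l0 (defect c)"
      by blast
    \<comment> \<open>An older location would be within \<open>slack\<close> of \<open>l0\<close>,
      hence closer to the defect than \<open>slack * Suc d\<close>. This drift is what lowers the
      counter by one.\<close>
    have "locations (touched b E) = {}"
    proof (rule ccontr)
      assume "\<not> ?thesis"
      then obtain l where l: "l \<in> locations (touched b E)" by blast
      then obtain e1 where e1: "\<bar>e1\<bar> \<le> int slack" "[l = l0 + e1] (mod period)"
        using locations_close[OF Y, of l0 l] l0 sub by blast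
      obtain e0 where e0: "\<bar>e0\<bar> < int (slack * d)" "[l0 = defect c + e0] (mod period)"
        using l0(2) by (auto simp: far_def)
      have "[l0 + e1 = defect c + e0 + e1] (mod period)" using e0 by (intro cong_add cong_refl)
      then have "[l = defect c + (e0 + e1)] (mod period)"
        using e1(2) by (metis cong_trans add.assoc)
      moreover have "\<bar>e0 + e1\<bar> < int (slack * Suc d)" using e0(1) e1(1) by (simp add: algebra_simps)
      ultimately show False using Bc(2)[OF l] by (auto simp: far_def)
    qed
    moreover have "touched b E \<subseteq> edges" by (auto simp: touched_def)
    ultimately have "\<not> unbalanced (touched b E)"
      using locations_nonempty finite_touched card by (meson less_imp_le_nat)
    then obtain B' c' where B'c': "odd_jump c'" "\<And>e'. e' \<in> touched b E \<Longrightarrow> \<not> pseudo B' c' e'"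
      by (auto simp: unbalanced_def)
    define B1 where "B1 = (\<lambda>i a. B i a \<noteq> B' i a)"
    define c1 where "c1 = (\<lambda>g. c g \<noteq> c' g)"
    have "pseudo B1 c1 e' = edge_value b (\<lambda>v. Neg v \<in> A) e'" if "e' \<in> complete b A" for e'
      using Bc(1) B'c'(2) that cA complete_subset_touched val[OF that]
      unfolding B1_def c1_def pseudo_xor by blast
    moreover have "far (int (slack * d)) l (defect c1)" if l: "l \<in> locations (touched b A)" for l
    proof -
      obtain e1 where "\<bar>e1\<bar> \<le> int slack" "[l = l0 + e1] (mod period)"
        using locations_close[OF Y, of l0 l] l0 l sub by blast
      moreover have "odd_jump c \<noteq> odd_jump c1" using B'c'(1) unfolding c1_def odd_jump_xor by blast
      ultimately show ?thesis using defect_far_apart D l0(2) by blast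
    qed
    ultimately show ?thesis
      unfolding good_def using pos by (intro conjI exI[of _ B1] exI[of _ c1]) auto
  qed
qed

text \<open>Insensitive to the sign of the pivot \<open>x\<close>, so that what a premise mentions
  is analysed once for both premises.\<close>

definition premise_on :: "nat \<Rightarrow> nat clause \<Rightarrow> nat clause \<Rightarrow> bool" where
  "premise_on x A E \<longleftrightarrow> is_clause A \<and> is_clause E \<and> x \<notin> var_of ` E \<and>
     (\<forall>l\<in>A. var_of l = x \<or> l \<in> E)"

lemma resolvent_premise_on:
  assumes "resolvent A B E" "is_clause A" "is_clause B" "is_clause E"
  obtains x where "premise_on x A E" "premise_on x B E" "Pos x \<in> A" "Neg x \<in> B"
proof -
  obtain x C D where x: "Pos x \<notin> C" "Neg x \<notin> D" "A = insert (Pos x) C" "B = insert (Neg x) D" "E = C \<union> D"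
    using assms(1) by (auto simp: resolvent_def)
  have "Neg x \<notin> A" "Pos x \<notin> B"
    using is_clause_Pos_Neg[OF assms(2), of x] is_clause_Pos_Neg[OF assms(3), of x] x by auto
  then have "l \<notin> E" if "var_of l = x" for l using that x by (cases l) auto
  then have "x \<notin> var_of ` E" by blast
  then show ?thesis using that[of x] x assms by (auto simp: premise_on_def)
qed

lemma premise_on_vars: "\<lbrakk>premise_on x A E; v \<in> var_of ` A; v \<noteq> x\<rbrakk> \<Longrightarrow> v \<in> var_of ` E"
  unfolding premise_on_def by blast

lemma premise_on_Neg:
  assumes "premise_on x A E" "v \<in> var_of ` A" "v \<noteq> x"
  shows "Neg v \<in> A \<longleftrightarrow> Neg v \<in> E"
proof -
  obtain l where l: "l \<in> A" "var_of l = v" using assms(2) by blast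
  then have "l \<in> E" using assms(1,3) by (auto simp: premise_on_def)
  then show ?thesis
    using l is_clause_Pos_Neg[of A v] is_clause_Pos_Neg[of E v] assms(1)
    by (cases l) (auto simp: premise_on_def)
qed

lemma premise_on_Pos:
  assumes "premise_on x A E" "good b E d" "Neg x \<in> A \<or> x \<in> copies b edges"
  shows "\<forall>v. Pos v \<in> A \<longrightarrow> v \<in> copies b edges"
proof (intro allI impI)
  fix v assume v: "Pos v \<in> A"
  show "v \<in> copies b edges"
  proof (cases "v = x")
    case True
    then show ?thesis using v assms(3) is_clause_Pos_Neg[of A x] assms(1) by (auto simp: premise_on_def)
  next
    case False
    then have "Pos v \<in> E" using v assms(1) by (auto simp: premise_on_def)
    then show ?thesis using assms(2) by (auto simp: good_def)
  qed
qed

lemma premise_on_mentioned: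
  assumes "premise_on x A E" "\<forall>i<b. copy e i \<noteq> x"
  shows "mentioned b A e \<subseteq> mentioned b E e"
proof
  fix j assume "j \<in> mentioned b A e"
  then show "j \<in> mentioned b E e"
    using premise_on_vars[OF assms(1), of "copy e j"] assms(2) by (simp add: mentioned_def)
qed

lemma premise_on_edge_value:
  assumes "premise_on x A E" "\<forall>i<b. copy e i \<noteq> x" "e \<in> complete b A"
  shows "edge_value b (\<lambda>v. Neg v \<in> A) e = edge_value b (\<lambda>v. Neg v \<in> E) e"
proof (rule edge_value_cong)
  fix i assume i: "i < b"
  then have "copy e i \<in> var_of ` A" using assms(3) by (auto simp: complete_def mentioned_def)
  then show "(Neg (copy e i) \<in> A) = (Neg (copy e i) \<in> E)"
    using premise_on_Neg[OF assms(1)] assms(2) i by blast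
qed

lemma mentioned_insert:
  assumes "premise_on x A E" "x = copy e i"
  shows "mentioned b A e \<subseteq> insert i (mentioned b E e)"
proof
  fix j assume "j \<in> mentioned b A e"
  then show "j \<in> insert i (mentioned b E e)"
    using premise_on_vars[OF assms(1), of "copy e j"] assms(2) by (auto simp: mentioned_def)
qed

text \<open>Only a variable that completes the block of an already touched edge may force the choice of a
  single premise, and then the premise agreeing with the pseudo-assignment is good without loss.\<close>

lemma good_step:
  assumes res: "resolvent A B E" "is_clause A" "is_clause B" "is_clause E"
    and w: "card E \<le> w" "w < (b - 1) * slack"
    and good: "good b E (Suc d)" and D: "2 * int (slack * Suc d) \<le> half"
  shows "good b A (Suc d) \<or> good b B (Suc d) \<or> good b A d \<and> good b B d"
proof -
  obtain x where A: "premise_on x A E" "Pos x \<in> A" and B: "premise_on x B E" "Neg x \<in> B"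
    using resolvent_premise_on[OF res] by blast
  obtain \<Phi> c where \<Phi>: "\<And>e. e \<in> complete b E \<Longrightarrow> pseudo \<Phi> c e = edge_value b (\<lambda>v. Neg v \<in> E) e"
    "\<And>l. l \<in> locations (touched b E) \<Longrightarrow> far (int (slack * Suc d)) l (defect c)"
    using good unfolding good_def by blast
  have keep: "good b C (Suc d)"
    if "\<forall>v. Pos v \<in> C \<longrightarrow> v \<in> copies b edges" "touched b C \<subseteq> touched b E"
      "\<forall>e\<in>complete b C. pseudo \<Phi> c e = edge_value b (\<lambda>v. Neg v \<in> C) e" for C
    unfolding good_def using that \<Phi>(2) locations_mono[OF that(2)] by blast
  show ?thesis
  proof (cases "x \<in> copies b edges")
    \<comment> \<open>A pivot that is no copy of an edge is always taken as true: the premise with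
      \<open>Neg x\<close> mentions no new copies, and negative literals on such variables are
      harmless.\<close>
    case False
    then have nx: "\<forall>i<b. copy e i \<noteq> x" if "e \<in> edges" for e using that by (auto simp: copies_def)
    have sub: "mentioned b B e \<subseteq> mentioned b E e" if "e \<in> edges" for e
      using premise_on_mentioned[OF B(1) nx[OF that]] .
    have "touched b B \<subseteq> touched b E"
    proof
      fix e assume e: "e \<in> touched b B"
      then have "card (mentioned b B e) \<le> card (mentioned b E e)"
        using sub by (intro card_mono[OF finite_mentioned]) (simp add: touched_def)
      then show "e \<in> touched b E" using e by (simp add: touched_def)
    qed
    moreover have "complete b B \<subseteq> complete b E"
    proof
      fix e assume "e \<in> complete b B"
      then have "e \<in> edges" "{..<b} \<subseteq> mentioned b E e" using sub by (auto simp: complete_def)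
      then show "e \<in> complete b E" by (auto simp: complete_def mentioned_def)
    qed
    moreover have "good b B (Suc d)" if "complete b B \<subseteq> complete b E" "touched b B \<subseteq> touched b E"
    proof (rule keep)
      show "\<forall>v. Pos v \<in> B \<longrightarrow> v \<in> copies b edges" using premise_on_Pos[OF B(1) good] B(2) by blast
      show "touched b B \<subseteq> touched b E" by (rule that(2))
      show "\<forall>e\<in>complete b B. pseudo \<Phi> c e = edge_value b (\<lambda>v. Neg v \<in> B) e"
        using that(1) \<Phi>(1) premise_on_edge_value[OF B(1) nx]
        by (auto simp: complete_def)
    qed
    ultimately show ?thesis by blast
  next
    case True
    then obtain e i where e: "e \<in> edges" "i < b" "x = copy e i" by (auto simp: copies_def)
    have i: "i \<notin> mentioned b E e"
      using A(1) e(3) by (auto simp: mentioned_def premise_on_def)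
    have posA: "\<forall>v. Pos v \<in> A \<longrightarrow> v \<in> copies b edges" and posB: "\<forall>v. Pos v \<in> B \<longrightarrow> v \<in> copies b edges"
      using premise_on_Pos[OF A(1) good] premise_on_Pos[OF B(1) good] True by blast+
    have nx: "\<forall>i<b. copy e' i \<noteq> x" if "e' \<noteq> e" for e' using that e(3) by simp
    have touch: "touched b C \<subseteq> insert e (touched b E)" if "premise_on x C E" for C
    proof
      fix e' assume e': "e' \<in> touched b C"
      show "e' \<in> insert e (touched b E)"
      proof (cases "e' = e")
        case False
        have "mentioned b C e' \<subseteq> mentioned b E e'" using premise_on_mentioned[OF that nx[OF False]] .
        then have "card (mentioned b C e') \<le> card (mentioned b E e')" by (rule card_mono[OF finite_mentioned])
        then show ?thesis using e' by (auto simp: touched_def)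
      qed simp
    qed
    have comp: "e' \<in> complete b E" if "premise_on x C E" "e' \<in> complete b C" "e' \<noteq> e" for C e'
    proof -
      have "e' \<in> edges" "{..<b} \<subseteq> mentioned b E e'"
        using premise_on_mentioned[OF that(1) nx[OF that(3)]] that(2) by (auto simp: complete_def)
      then show ?thesis by (auto simp: complete_def mentioned_def)
    qed
    have val: "edge_value b (\<lambda>v. Neg v \<in> C) e' = edge_value b (\<lambda>v. Neg v \<in> E) e'"
      if "premise_on x C E" "e' \<in> complete b C" "e' \<noteq> e" for C e'
      using premise_on_edge_value[OF that(1) nx[OF that(3)] that(2)] .
    show ?thesis
    proof (cases "e \<in> complete b A \<or> e \<in> complete b B")
      case False
      have "good b C d" if C: "premise_on x C E" "e \<notin> complete b C" "\<forall>v. Pos v \<in> C \<longrightarrow> v \<in> copies b edges" for C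
      proof (rule good_touch_edge[OF good D card_touched_less[OF res(4) w] e(1)])
        show "touched b C \<subseteq> insert e (touched b E)" by (rule touch[OF C(1)])
        show "complete b C \<subseteq> complete b E" using comp[OF C(1)] C(2) by blast
        show "edge_value b (\<lambda>v. Neg v \<in> C) e' = edge_value b (\<lambda>v. Neg v \<in> E) e'"
          if "e' \<in> complete b C" for e' using val[OF C(1) that] that C(2) by blast
      qed (rule C(3))
      then show ?thesis using A B False posA posB by blast
    next
      case True
      then obtain C where "premise_on x C E" "e \<in> complete b C" using A B by blast
      then have "{..<b} \<subseteq> insert i (mentioned b E e)"
        using mentioned_insert[OF _ e(3), of C E b] by (auto simp: complete_def)
      then have "{..<b} - {i} \<subseteq> mentioned b E e" by blast
      then have "card ({..<b} - {i}) \<le> card (mentioned b E e)" by (rule card_mono[OF finite_mentioned])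
      then have "e \<in> touched b E" using e by (simp add: touched_def)
      then have tA: "touched b A \<subseteq> touched b E" and tB: "touched b B \<subseteq> touched b E"
        using touch A(1) B(1) by blast+
      have keep': "good b C (Suc d)" if C: "premise_on x C E" "\<forall>v. Pos v \<in> C \<longrightarrow> v \<in> copies b edges"
        "touched b C \<subseteq> touched b E"
        "e \<in> complete b C \<Longrightarrow> pseudo \<Phi> c e = edge_value b (\<lambda>v. Neg v \<in> C) e" for C
      proof (rule keep[OF C(2,3)], rule ballI)
        fix e' assume e': "e' \<in> complete b C"
        show "pseudo \<Phi> c e' = edge_value b (\<lambda>v. Neg v \<in> C) e'"
          using C(4) e' val[OF C(1) e'] comp[OF C(1) e'] \<Phi>(1) by (cases "e' = e") auto
      qed
      \<comment> \<open>The premises fix the same values on all other copies of \<open>e\<close> and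
        opposite values on the pivot, so exactly one exclusive or matches the
        pseudo-assignment.\<close>
      have "edge_value b (\<lambda>v. Neg v \<in> A) e \<noteq> edge_value b (\<lambda>v. Neg v \<in> B) e"
        if c: "e \<in> complete b A" "e \<in> complete b B"
      proof -
        have vars: "copy e j \<in> var_of ` A" "copy e j \<in> var_of ` B" if "j < b" for j
          using c that by (auto simp: complete_def mentioned_def)
        have "Neg (copy e j) \<in> A \<longleftrightarrow> Neg (copy e j) \<in> B" if "j < b" "j \<noteq> i" for j
          using premise_on_Neg[OF A(1) vars(1)] premise_on_Neg[OF B(1) vars(2)] that e(3) by simp
        moreover have "Neg (copy e i) \<notin> A" "Neg (copy e i) \<in> B"
          using A B e(3) is_clause_Pos_Neg[of A x] by (auto simp: premise_on_def)
        ultimately have eq: "{j. j < b \<and> Neg (copy e j) \<in> B} = insert i {j. j < b \<and> Neg (copy e j) \<in> A}"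
          and notin: "i \<notin> {j. j < b \<and> Neg (copy e j) \<in> A}"
          using e(2) by blast+
        show ?thesis unfolding edge_value_def eq using notin by simp
      qed
      then have "(e \<in> complete b A \<longrightarrow> pseudo \<Phi> c e = edge_value b (\<lambda>v. Neg v \<in> A) e) \<or>
          (e \<in> complete b B \<longrightarrow> pseudo \<Phi> c e = edge_value b (\<lambda>v. Neg v \<in> B) e)"
        by blast
      then show ?thesis
        using keep'[OF A(1) posA tA] keep'[OF B(1) posB tB] by blast
    qed
  qed
qed

text \<open>An axiom completes all its edges, so the pseudo-assignment would violate its equation.
  Local equations are never violated, and a violated ring is a location at distance zero from the
  defect.\<close>

lemma good_axiom:
  assumes b: "0 < b" and C: "C \<in> formula b n" and good: "good b C d"
  shows "d = 0"
proof (rule ccontr)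
  assume d: "d \<noteq> 0"
  obtain \<Phi> c where \<Phi>: "\<And>e. e \<in> complete b C \<Longrightarrow> pseudo \<Phi> c e = edge_value b (\<lambda>v. Neg v \<in> C) e"
    "\<And>l. l \<in> locations (touched b C) \<Longrightarrow> far (int (slack * d)) l (defect c)"
    and pos: "\<And>x. Pos x \<in> C \<Longrightarrow> x \<in> copies b edges"
    using good unfolding good_def by blast
  consider j where "C = {Pos (pad j)}" | es r where "(es, r) \<in> system" "C \<in> encode b (es, r)"
    using C by (force simp: formula_def base_cnf_def)
  then show False
  proof cases
    case 1
    then have "pad j \<in> copies b edges" using pos by simp
    then show False by (auto simp: copies_def) (metis copy_neq_pad)
  next
    case 2
    obtain \<alpha> where \<alpha>: "C = full_clause (copies b (set es)) \<alpha>" "parity (edge_value b \<alpha>) es \<noteq> r"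
      using 2(2) by auto
    have comp: "set es \<subseteq> complete b C"
      using system_edges[OF 2(1)]
      by (auto simp: complete_def mentioned_def \<alpha>(1) var_of_full_clause copies_def)
    have "pseudo \<Phi> c e = edge_value b \<alpha> e" if e: "e \<in> set es" for e
    proof -
      have "edge_value b (\<lambda>v. Neg v \<in> C) e = edge_value b \<alpha> e"
        using e by (intro edge_value_cong) (auto simp: \<alpha>(1) Neg_in_full_clause copies_def)
      then show ?thesis using \<Phi>(1) comp e by auto
    qed
    then have viol: "parity (pseudo \<Phi> c) es \<noteq> r" using \<alpha>(2) parity_cong by metis
    have no: False if "es = ring t" "defect c = t" for t
    proof -
      have "t \<in> locations (touched b C)"
        using comp complete_subset_touched that by (intro ring_location) blast
      then have "far (int (slack * d)) t t" using \<Phi>(2) that by blast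
      moreover have "0 < slack * d" using d R_pos R_less by (simp add: slack_def)
      ultimately show False by (auto simp: far_def dest!: spec[of _ 0])
    qed
    consider g a where "g < k" "es = local_eq g a" "r = False" | "es = ring 0" "r = True" |
      "es = ring half" "r = False"
      using 2(1) by (auto simp: system_def)
    then show False
    proof cases
      case 1 then show False using viol parity_local_eq by simp
    next
      case 2 then show False using viol no by (simp add: parity_ring defect_def)
    next
      case 3 then show False using viol no by (simp add: parity_ring defect_def)
    qed
  qed
qed

text \<open>For \<open>2 \<le> b\<close> the threshold \<open>b - 1\<close> is positive, so the
  empty clause touches nothing and no location limits \<open>d\<close>.\<close>

lemma good_root:
  assumes "2 \<le> b"
  shows "good b {} d"
proof -
  have "touched b {} = {}"
    using assms by (auto simp: touched_def mentioned_def)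
  moreover from this have "complete b {} = {}"
    using complete_subset_touched by blast
  moreover have "\<not> unbalanced {}"
    using odd_jump_single[OF k_pos] by (auto simp: unbalanced_def)
  ultimately show ?thesis by (simp add: good_def locations_def)
qed

theorem treelike_size_formula:
  assumes "2 \<le> b" "refutation (formula b n) \<pi>" "treelike \<pi>" "ref_width \<pi> < (b - 1) * slack"
    and D: "2 * int (slack * D) \<le> half"
  shows "2 ^ D - 1 \<le> ref_size \<pi>"
proof (rule treelike_size_lower_bound[OF assms(2,3) order_refl, where G = "good b" and D = D])
  show "d = 0" if "C \<in> formula b n" "good b C d" for C d
    using good_axiom[OF _ that] assms(1) by simp
  show "good b {} D" by (rule good_root[OF assms(1)])
  fix A B E d
  assume *: "resolvent A B E" "is_clause A" "is_clause B" "is_clause E" "card E \<le> ref_width \<pi>"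
    "good b E (Suc d)" "Suc d \<le> D"
  have "2 * int (slack * Suc d) \<le> 2 * int (slack * D)"
    using *(7) by (intro mult_left_mono zle_int[THEN iffD2] mult_le_mono2) auto
  then show "good b A (Suc d) \<or> good b B (Suc d) \<or> good b A d \<and> good b B d"
    using good_step[OF *(1-5) assms(4) *(6)] D by linarith
qed

end

lemma edge_value_full: "\<lbrakk>\<forall>x\<in>copies b Y. \<alpha> x = \<beta> x; e \<in> Y\<rbrakk> \<Longrightarrow> edge_value b \<alpha> e = edge_value b \<beta> e"
  by (intro edge_value_cong) (auto simp: copies_def)

lemma card_copies_list_le: "card (copies b (set es)) \<le> b * length es"
  using card_copies_le[OF finite_set[of es]] mult_le_mono2[OF card_length[of es]] by (rule le_trans)

lemma copies_mono: "Y \<subseteq> Z \<Longrightarrow> copies b Y \<subseteq> copies b Z"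
  by (auto simp: copies_def)

lemma derivable_mono: "\<lbrakk>derivable F w C; F \<subseteq> F'\<rbrakk> \<Longrightarrow> derivable F' w C"
  by (induction rule: derivable.induct) (auto intro: derivable.intros)

context cylinder
begin

subsection \<open>The upper bound\<close>

text \<open>Resolution has no weakening, so instead of the full clauses encoding an equation only
  some falsified clause per violating assignment is demanded.\<close>

definition derives :: "nat \<Rightarrow> nat \<Rightarrow> edge list \<Rightarrow> bool \<Rightarrow> bool" where
  "derives b w es r \<longleftrightarrow> (\<forall>\<alpha>. parity (edge_value b \<alpha>) es \<noteq> r \<longrightarrow>
     (\<exists>C. derivable (base_cnf b) w C \<and> var_of ` C \<subseteq> copies b (set es) \<and> falsified \<alpha> C))"

lemma derives_axiom:
  assumes "(es, r) \<in> system" "b * length es \<le> w"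
  shows "derives b w es r"
  unfolding derives_def
proof (intro allI impI)
  fix \<alpha> assume \<alpha>: "parity (edge_value b \<alpha>) es \<noteq> r"
  define C where "C = full_clause (copies b (set es)) \<alpha>"
  have "C \<in> encode b (es, r)" using \<alpha> by (auto simp: C_def)
  then have "C \<in> base_cnf b" using assms(1) unfolding base_cnf_def by blast
  moreover have C: "falsified \<alpha> C" "var_of ` C \<subseteq> copies b (set es)"
    by (simp_all add: C_def falsified_full_clause var_of_full_clause)
  moreover have "is_clause C" "card C \<le> card (copies b (set es))"
    using falsified_imp_is_clause[OF C finite_copies] by auto
  moreover have "card (copies b (set es)) \<le> w"
    using card_copies_list_le assms(2) by (rule le_trans)
  ultimately show "\<exists>C. derivable (base_cnf b) w C \<and> var_of ` C \<subseteq> copies b (set es) \<and> falsified \<alpha> C"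
    by (meson derivable.ax le_trans)
qed

text \<open>An assignment violating the sum violates a summand, and the extra variables are then
  projected away. \<open>zs\<close> lists all edges involved at that moment, so it governs the
  width.\<close>

lemma derives_add:
  assumes "derives b w es r" "derives b w es' r'"
    and all: "set es \<union> set es' \<union> set es'' \<subseteq> set zs" "b * length zs \<le> w"
    and par: "\<And>\<beta>. parity \<beta> es'' = (parity \<beta> es \<noteq> parity \<beta> es')"
    and r: "r'' = (r \<noteq> r')"
  shows "derives b w es'' r''"
  unfolding derives_def
proof (intro allI impI)
  fix \<alpha> assume \<alpha>: "parity (edge_value b \<alpha>) es'' \<noteq> r''"
  have sub: "copies b (set es) \<subseteq> copies b (set zs)" "copies b (set es') \<subseteq> copies b (set zs)"
    "copies b (set es'') \<subseteq> copies b (set zs)"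
    using all(1) by (auto intro!: copies_mono)
  show "\<exists>C. derivable (base_cnf b) w C \<and> var_of ` C \<subseteq> copies b (set es'') \<and> falsified \<alpha> C"
  proof (rule derivable_project[where Q = "\<lambda>\<alpha>. parity (edge_value b \<alpha>) es'' = r''"
        and V = "copies b (set zs)"])
    show "finite (copies b (set zs))" "finite (copies b (set es''))" by (simp_all add: finite_copies)
    show "card (copies b (set zs) \<union> copies b (set es'')) \<le> w"
      unfolding Un_absorb2[OF sub(3)] using card_copies_list_le all(2) by (rule le_trans)
    fix \<alpha> \<beta> :: "nat \<Rightarrow> bool" assume eq: "\<forall>x\<in>copies b (set es''). \<alpha> x = \<beta> x"
    have "parity (edge_value b \<alpha>) es'' = parity (edge_value b \<beta>) es''"
      by (rule parity_cong, rule edge_value_full[OF eq])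
    then show "(parity (edge_value b \<alpha>) es'' = r'') = (parity (edge_value b \<beta>) es'' = r'')" by simp
  next
    fix \<alpha> assume "parity (edge_value b \<alpha>) es'' \<noteq> r''"
    then have "parity (edge_value b \<alpha>) es \<noteq> r \<or> parity (edge_value b \<alpha>) es' \<noteq> r'"
      unfolding par r by blast
    then obtain C where "derivable (base_cnf b) w C" "falsified \<alpha> C"
      "var_of ` C \<subseteq> copies b (set es) \<or> var_of ` C \<subseteq> copies b (set es')"
      using assms(1,2) unfolding derives_def by blast
    then show "\<exists>C. derivable (base_cnf b) w C \<and>
        var_of ` C \<subseteq> copies b (set zs) \<union> copies b (set es'') \<and> falsified \<alpha> C"
      using sub by (intro exI[of _ C]) auto
  qed (use \<alpha> in simp)
qed

text \<open>The sum of all equations behind a staircase-shaped cut: below \<open>i\<close> it has already advanced to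
  \<open>t + 1\<close>.\<close>

definition staircase :: "int \<Rightarrow> nat \<Rightarrow> edge list" where
  "staircase t i = map (\<lambda>g. rung g (t + 1)) [0..<i] @ map (\<lambda>g. rung g t) [i..<k] @
     [step 0 t, step (i mod k) t]"

lemma local_eq_in_system:
  assumes "g < k"
  shows "(local_eq g a, False) \<in> system"
proof -
  have "rung g (a mod gapmod g) = rung g a" "rung g (a mod gapmod g + 1) = rung g (a + 1)"
    by (simp_all add: rung_def mod_simps)
  moreover have "step g (a mod gapmod g) = step g a" "step (nxt g) (a mod gapmod g) = step (nxt g) a"
    using laymod_dvd(1)[of g] laymod_dvd(2)[OF assms] by (simp_all add: step_def mod_mod_cancel)
  ultimately have "local_eq g a = local_eq g (a mod gapmod g)"
    by (simp add: local_eq_def)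
  moreover have "a mod gapmod g \<in> {0..<gapmod g}" using gapmod_pos[of g] by simp
  ultimately show ?thesis using assms unfolding system_def by blast
qed

text \<open>Adding the face in gap \<open>i\<close> trades its rung at \<open>t\<close> for the one
  at \<open>t + 1\<close> and moves the step one layer on. The \<open>k + 2\<close> entries of the
  staircase and the two new ones give the \<open>k + 4\<close> in the width.\<close>

lemma derives_staircase_Suc:
  assumes der: "derives b w (staircase t i) True" and i: "i < k" and w: "b * (k + 4) \<le> w"
  shows "derives b w (staircase t (Suc i)) True"
proof (rule derives_add[OF der, where es' = "local_eq i t" and r' = False
      and zs = "staircase t i @ [rung i (t + 1), step (nxt i) t]"])
  have 1: "Suc i mod k = nxt i" by (simp add: nxt_def)
  have 2: "[i..<k] = i # [Suc i..<k]" using i by (rule upt_conv_Cons)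
  have 3: "i mod k = i" using i by simp
  have 4: "[0..<Suc i] = [0..<i] @ [i]" by simp
  show "derives b w (local_eq i t) False"
  proof (rule derives_axiom[OF local_eq_in_system[OF i]])
    have "b * length (local_eq i t) \<le> b * (k + 4)" by (intro mult_le_mono2) (simp add: local_eq_def)
    then show "b * length (local_eq i t) \<le> w" using w by (rule le_trans)
  qed
  show "set (staircase t i) \<union> set (local_eq i t) \<union> set (staircase t (Suc i))
      \<subseteq> set (staircase t i @ [rung i (t + 1), step (nxt i) t])"
    unfolding staircase_def local_eq_def 1 2 3 4 by auto
  show "b * length (staircase t i @ [rung i (t + 1), step (nxt i) t]) \<le> w"
  proof -
    have "length (staircase t i @ [rung i (t + 1), step (nxt i) t]) = k + 4"
      using i by (simp add: staircase_def)
    then show ?thesis using w by metis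
  qed
  show "parity \<beta> (staircase t (Suc i)) = (parity \<beta> (staircase t i) \<noteq> parity \<beta> (local_eq i t))" for \<beta>
  proof -
    have cancel: "(x \<noteq> ((h' \<noteq> False) \<noteq> (y \<noteq> (e \<noteq> (f \<noteq> False))))) =
        ((x \<noteq> ((h \<noteq> y) \<noteq> (e \<noteq> (g \<noteq> False)))) \<noteq> (h \<noteq> (h' \<noteq> (g \<noteq> (f \<noteq> False)))))"
      for x h h' y e f g :: bool
      by (cases x; cases h; cases h'; cases y; cases e; cases f; cases g) simp_all
    show ?thesis
      unfolding staircase_def local_eq_def 1 2 3 4 map_append list.map append_assoc parity_append
        parity_Cons parity_Nil
      by (rule cancel)
  qed
qed simp

text \<open>Inserts or deletes pairs of equal edges, by adding the empty equation.\<close>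

lemma derives_same_parity:
  assumes der: "derives b w es True" and par: "\<And>\<beta>. parity \<beta> es' = parity \<beta> es"
    and "set es \<union> set es' \<subseteq> set zs" "b * length zs \<le> w"
  shows "derives b w es' True"
proof -
  have "derives b w [] False" by (simp add: derives_def)
  then show ?thesis by (rule derives_add[OF der, where zs = zs]) (use assms in auto)
qed

text \<open>At the start and at the end of a turn both step entries are \<open>step 0 t\<close>;
  they cancel and leave the ring at \<open>t\<close> and at \<open>t + 1\<close>,
  respectively.\<close>

lemma derives_ring:
  assumes w: "b * (k + 4) \<le> w"
  shows "derives b w (ring (int t)) True"
proof (induction t)
  case 0
  have "b * length (ring 0) \<le> b * (k + 4)" by (intro mult_le_mono2) (simp add: ring_def)
  then have "b * length (ring 0) \<le> w" using w by (rule le_trans)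
  then show ?case using derives_axiom[of "ring 0" True b w] by (simp add: system_def)
next
  case (Suc t)
  have len: "b * length (staircase (int t) i) \<le> w" if "i \<le> k" for i
  proof -
    have "b * length (staircase (int t) i) \<le> b * (k + 4)"
      using that by (intro mult_le_mono2) (simp add: staircase_def)
    then show ?thesis using w by (rule le_trans)
  qed
  have st: "derives b w (staircase (int t) i) True" if "i \<le> k" for i
    using that
  proof (induction i)
    case 0
    have eq: "staircase (int t) 0 = ring (int t) @ [step 0 (int t), step 0 (int t)]"
      by (simp add: staircase_def ring_def)
    show ?case
      by (rule derives_same_parity[OF Suc, where zs = "staircase (int t) 0"])
        (use len[of 0] in \<open>auto simp: eq\<close>)
  next
    case (Suc i)
    then show ?case using derives_staircase_Suc w by simp
  qed
  have eq: "staircase (int t) k = ring (int (Suc t)) @ [step 0 (int t), step 0 (int t)]"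
    by (simp add: staircase_def ring_def add.commute)
  show ?case
    by (rule derives_same_parity[OF st[OF order_refl], where zs = "staircase (int t) k"])
      (use len[of k] in \<open>auto simp: eq\<close>)
qed

lemma derivable_empty:
  assumes w: "b * (k + 4) \<le> w"
  shows "derivable (base_cnf b) w {}"
proof -
  have half: "int (nat half) = half" using period_pos by (simp add: half_def)
  have len: "b * length (ring half) \<le> w"
  proof -
    have "b * length (ring half) \<le> b * (k + 4)" by (intro mult_le_mono2) (simp add: ring_def)
    then show ?thesis using w by (rule le_trans)
  qed
  have "derives b w (ring half) False"
    using len by (intro derives_axiom) (simp_all add: system_def)
  moreover have "derives b w (ring half) True"
    using derives_ring[OF w, of "nat half"] half by simp
  ultimately have "derives b w [] True"
    by (rule derives_add[where zs = "ring half"]) (use len in auto)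
  then show ?thesis by (auto simp: derives_def copies_def)
qed

lemma min_width_formula: "min_width (formula b n) \<le> b * (k + 4)"
  and formula_unsatisfiable: "\<not> satisfiable (formula b n)"
proof -
  have "derivable (formula b n) (b * (k + 4)) {}"
    using derivable_mono[OF derivable_empty[OF order_refl]] by (auto simp: formula_def)
  then show "min_width (formula b n) \<le> b * (k + 4)" "\<not> satisfiable (formula b n)"
    using min_width_le_of_derivable unsatisfiable_of_derivable by blast+
qed

subsection \<open>Size\<close>

lemma encode_clause:
  assumes "(es, r) \<in> system" "C \<in> encode b (es, r)"
  shows "is_clause C" "card C \<le> b * length es" "var_of ` C \<subseteq> copies b edges"
proof -
  obtain \<alpha> where \<alpha>: "C = full_clause (copies b (set es)) \<alpha>" using assms(2) by auto
  have C: "falsified \<alpha> C" "var_of ` C \<subseteq> copies b (set es)"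
    by (simp_all add: \<alpha> falsified_full_clause var_of_full_clause)
  show "is_clause C" using falsified_imp_is_clause(1)[OF C finite_copies] by simp
  have "card C \<le> card (copies b (set es))" using falsified_imp_is_clause(2)[OF C finite_copies] by simp
  then show "card C \<le> b * length es" using card_copies_list_le by (rule le_trans)
  show "var_of ` C \<subseteq> copies b edges"
    using C(2) copies_mono[OF system_edges[OF assms(1)]] by (rule order_trans)
qed

lemma card_encode: "finite (encode b (es, r))" "card (encode b (es, r)) \<le> 2 ^ (b * length es)"
proof -
  define V where "V = copies b (set es)"
  have V: "finite V" "card V \<le> b * length es"
    by (simp_all add: V_def finite_copies card_copies_list_le)
  have full: "full_clause V \<alpha> = full_clause V (\<lambda>v. v \<in> {v\<in>V. \<alpha> v})" for \<alpha>
    unfolding full_clause_def by (rule image_cong) auto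
  have sub: "encode b (es, r) \<subseteq> (\<lambda>W. full_clause V (\<lambda>v. v \<in> W)) ` Pow V"
  proof
    fix C assume "C \<in> encode b (es, r)"
    then obtain \<alpha> where "C = full_clause V \<alpha>" by (auto simp: V_def)
    then have "C = full_clause V (\<lambda>v. v \<in> {v\<in>V. \<alpha> v})" using full by simp
    then show "C \<in> (\<lambda>W. full_clause V (\<lambda>v. v \<in> W)) ` Pow V" by blast
  qed
  show "finite (encode b (es, r))" using finite_subset[OF sub] V(1) by simp
  have "card (encode b (es, r)) \<le> card (Pow V)" using surj_card_le[OF _ sub] V(1) by simp
  also have "\<dots> = 2 ^ card V" using V by (simp add: card_Pow)
  also have "\<dots> \<le> 2 ^ (b * length es)" using V(2) by (intro power_increasing) auto
  finally show "card (encode b (es, r)) \<le> 2 ^ (b * length es)" .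
qed

lemma finite_system: "finite system"
proof -
  have "{(local_eq g a, False) |g a. g < k \<and> a \<in> {0..<gapmod g}} =
      (\<Union>g\<in>{..<k}. (\<lambda>a. (local_eq g a, False)) ` {0..<gapmod g})" by blast
  then show ?thesis unfolding system_def by simp
qed

lemma finite_base_cnf: "finite (base_cnf b)"
  unfolding base_cnf_def
proof (rule finite_UN_I[OF finite_system])
  show "finite (encode b s)" for s using card_encode(1) by (cases s) blast
qed

lemma base_cnf_cases:
  assumes "C \<in> base_cnf b"
  obtains es r where "(es, r) \<in> system" "C \<in> encode b (es, r)"
proof -
  obtain s where "s \<in> system" "C \<in> encode b s" using assms by (auto simp: base_cnf_def)
  then show ?thesis using that by (cases s) blast
qed

lemma is_cnf_formula: "is_cnf (formula b n)"
proof -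
  have "is_clause C" if "C \<in> base_cnf b" for C
    using base_cnf_cases[OF that] encode_clause(1) by metis
  moreover have "is_clause {Pos (pad j)}" for j by (simp add: is_clause_def)
  ultimately show ?thesis using finite_base_cnf by (auto simp: is_cnf_def formula_def)
qed

lemma base_vars: "cnf_vars (base_cnf b) \<subseteq> copies b edges"
proof -
  have "var_of ` C \<subseteq> copies b edges" if "C \<in> base_cnf b" for C
    using base_cnf_cases[OF that] encode_clause(3) by metis
  then show ?thesis unfolding cnf_vars_def by (rule UN_least)
qed

lemma card_vars_formula: "card (cnf_vars (formula b n)) = card (cnf_vars (base_cnf b)) + n"
proof -
  have eq: "cnf_vars (formula b n) = cnf_vars (base_cnf b) \<union> pad ` {..<n}"
    by (auto simp: cnf_vars_def formula_def)
  have "finite (cnf_vars (base_cnf b))"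
    using finite_subset[OF base_vars finite_copies[OF finite_edges]] .
  moreover have "cnf_vars (base_cnf b) \<inter> pad ` {..<n} = {}"
  proof -
    have "pad j \<notin> copies b edges" for j
      unfolding copies_def using copy_neq_pad[symmetric] by blast
    then show ?thesis using base_vars by blast
  qed
  moreover have "inj_on pad {..<n}" by (simp add: inj_on_def pad_def)
  ultimately show ?thesis unfolding eq
    by (subst card_Un_disjoint) (auto simp: card_image)
qed

lemma card_base_vars_le:
  assumes "\<And>g. g < k \<Longrightarrow> gapmod g \<le> int m"
  shows "card (cnf_vars (base_cnf b)) \<le> 2 * b * k * m"
proof -
  let ?U = "\<lambda>g. Rung g ` {0..<int m} \<union> Step g ` {0..<int m}"
  have lay: "laymod i \<le> int m" if "i < k" for i
    using zdvd_imp_le[OF laymod_dvd(1)[of i] gapmod_pos] assms[OF that] by simp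
  have sub: "edges \<subseteq> (\<Union>g\<in>{..<k}. ?U g)"
  proof
    fix e assume "e \<in> edges"
    then consider g a where "e = Rung g a" "g < k" "0 \<le> a" "a < gapmod g" |
      i a where "e = Step i a" "i < k" "0 \<le> a" "a < laymod i" by (auto simp: edges_def)
    then show "e \<in> (\<Union>g\<in>{..<k}. ?U g)"
    proof cases
      case (1 g a)
      then have "a < int m" using assms[of g] by simp
      then show ?thesis using 1 by (intro UN_I[of g]) auto
    next
      case (2 i a)
      then have "a < int m" using lay[of i] by simp
      then show ?thesis using 2 by (intro UN_I[of i]) auto
    qed
  qed
  have "card edges \<le> card (\<Union>g\<in>{..<k}. ?U g)" using sub by (intro card_mono) auto
  also have "\<dots> \<le> (\<Sum>g<k. card (?U g))" by (rule card_UN_le) simp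
  also have "\<dots> \<le> (\<Sum>g<k. 2 * m)"
  proof (rule sum_mono)
    fix g
    have "card (?U g) \<le> card (Rung g ` {0..<int m}) + card (Step g ` {0..<int m})" by (rule card_Un_le)
    also have "\<dots> \<le> card {0..<int m} + card {0..<int m}" by (intro add_mono card_image_le) auto
    finally show "card (?U g) \<le> 2 * m" by simp
  qed
  finally have "card edges \<le> k * (2 * m)" by simp
  then have "b * card edges \<le> b * (k * (2 * m))" by (rule mult_le_mono2)
  moreover have "card (cnf_vars (base_cnf b)) \<le> card (copies b edges)"
    using base_vars finite_copies[OF finite_edges] by (intro card_mono)
  moreover have "card (copies b edges) \<le> b * card edges" by (rule card_copies_le[OF finite_edges])
  ultimately have "card (cnf_vars (base_cnf b)) \<le> b * (k * (2 * m))" by linarith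
  then show ?thesis by (simp add: mult_ac)
qed

lemma cnf_size_Un_le: "\<lbrakk>finite F; finite F'\<rbrakk> \<Longrightarrow> cnf_size (F \<union> F') \<le> cnf_size F + cnf_size F'"
  unfolding cnf_size_def using sum.union_inter[of F F' clause_width] by linarith

lemma cnf_size_UN_le:
  assumes "finite S" "\<And>s. s \<in> S \<Longrightarrow> finite (f s)"
  shows "cnf_size (\<Union>s\<in>S. f s) \<le> (\<Sum>s\<in>S. cnf_size (f s))"
  using assms
proof (induction S rule: finite_induct)
  case (insert s S)
  have "cnf_size (f s \<union> (\<Union>s\<in>S. f s)) \<le> cnf_size (f s) + cnf_size (\<Union>s\<in>S. f s)"
    using insert by (intro cnf_size_Un_le) auto
  moreover have "cnf_size (\<Union>s\<in>S. f s) \<le> (\<Sum>s\<in>S. cnf_size (f s))" using insert by simp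
  ultimately show ?case using insert by simp
qed (simp add: cnf_size_def)

lemma cnf_size_encode_le:
  assumes "(es, r) \<in> system"
  shows "cnf_size (encode b (es, r)) \<le> b * length es * 2 ^ (b * length es)"
proof -
  have "cnf_size (encode b (es, r)) \<le> (\<Sum>C\<in>encode b (es, r). b * length es)"
    unfolding cnf_size_def clause_width_def by (intro sum_mono encode_clause(2)[OF assms])
  also have "\<dots> = card (encode b (es, r)) * (b * length es)" by (simp del: encode.simps)
  also have "\<dots> \<le> 2 ^ (b * length es) * (b * length es)" by (intro mult_le_mono1 card_encode(2))
  finally show ?thesis by (simp only: mult.commute)
qed

lemma cnf_size_formula_le:
  assumes m: "\<And>g. g < k \<Longrightarrow> gapmod g \<le> int m"
  shows "cnf_size (formula b n) \<le> k * m * (b * 4 * 2 ^ (b * 4)) + 2 * (b * k * 2 ^ (b * k)) + n"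
proof -
  let ?loc = "\<lambda>g. (\<lambda>a. (local_eq g a, False)) ` {0..<gapmod g}"
  let ?L = "\<Union>g\<in>{..<k}. ?loc g"
  let ?R = "{(ring 0, True), (ring half, False)}"
  let ?f = "\<lambda>s. cnf_size (encode b s)"
  have sys: "system = ?L \<union> ?R" by (auto simp: system_def)
  have fin: "finite ?L" by simp
  have cardL: "card ?L \<le> k * m"
  proof -
    have "card ?L \<le> (\<Sum>g<k. card (?loc g))" by (rule card_UN_le) simp
    also have "\<dots> \<le> (\<Sum>g<k. m)"
    proof (rule sum_mono)
      fix g assume "g \<in> {..<k}"
      then have "card {0..<gapmod g} \<le> m" using m[of g] by simp
      moreover have "card (?loc g) \<le> card {0..<gapmod g}" by (rule card_image_le) simp
      ultimately show "card (?loc g) \<le> m" by linarith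
    qed
    finally show ?thesis by simp
  qed
  have fL: "?f s \<le> b * 4 * 2 ^ (b * 4)" if "s \<in> ?L" for s
  proof -
    obtain g a where s: "s = (local_eq g a, False)" using \<open>s \<in> ?L\<close> by blast
    then have "(local_eq g a, False) \<in> system" using that sys by blast
    moreover have "length (local_eq g a) = 4" by (simp add: local_eq_def)
    ultimately show ?thesis using cnf_size_encode_le[of "local_eq g a" False b] unfolding s by metis
  qed
  have fR: "?f s \<le> b * k * 2 ^ (b * k)" if s: "s \<in> ?R" for s
  proof -
    obtain t r where s': "s = (ring t, r)" using s by blast
    moreover have "s \<in> system" using s unfolding sys by blast
    moreover have "length (ring t) = k" by (simp add: ring_def)
    ultimately show ?thesis using cnf_size_encode_le[of "ring t" r b] by metis
  qed
  have "cnf_size (base_cnf b) \<le> sum ?f system"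
    unfolding base_cnf_def
  proof (rule cnf_size_UN_le[OF finite_system])
    show "finite (encode b s)" for s using card_encode(1) by (cases s) blast
  qed
  also have "\<dots> \<le> sum ?f ?L + sum ?f ?R"
  proof -
    have "sum ?f (?L \<union> ?R) + sum ?f (?L \<inter> ?R) = sum ?f ?L + sum ?f ?R"
      by (rule sum.union_inter[OF fin]) simp
    then show ?thesis unfolding sys by linarith
  qed
  also have "sum ?f ?R \<le> of_nat (card ?R) * (b * k * 2 ^ (b * k))"
    by (rule sum_bounded_above) (rule fR)
  also have "\<dots> \<le> 2 * (b * k * 2 ^ (b * k))"
    by (intro mult_le_mono1) (simp add: card_insert_if)
  also have "sum ?f ?L \<le> of_nat (card ?L) * (b * 4 * 2 ^ (b * 4))"
    by (rule sum_bounded_above) (rule fL)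
  also have "\<dots> \<le> k * m * (b * 4 * 2 ^ (b * 4))"
    using cardL by (intro mult_le_mono1) simp
  finally have base: "cnf_size (base_cnf b) \<le> k * m * (b * 4 * 2 ^ (b * 4)) + 2 * (b * k * 2 ^ (b * k))"
    by linarith
  have "cnf_size ((\<lambda>j. {Pos (pad j)}) ` {..<n}) = (\<Sum>C\<in>(\<lambda>j. {Pos (pad j)}) ` {..<n}. 1)"
    unfolding cnf_size_def by (intro sum.cong) (auto simp: clause_width_def)
  also have "\<dots> = card ((\<lambda>j. {Pos (pad j)}) ` {..<n})" by simp
  also have "\<dots> \<le> n" using card_image_le[of "{..<n}" "\<lambda>j. {Pos (pad j)}"] by simp
  finally have "cnf_size ((\<lambda>j. {Pos (pad j)}) ` {..<n}) \<le> n" .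
  moreover have "cnf_size (formula b n) \<le> cnf_size (base_cnf b) + cnf_size ((\<lambda>j. {Pos (pad j)}) ` {..<n})"
    unfolding formula_def using finite_base_cnf by (intro cnf_size_Un_le) auto
  ultimately show ?thesis using base by linarith
qed

end

subsection \<open>Choice of the moduli\<close>

text \<open>The moduli of Goedel's beta function.\<close>

lemma coprime_beta:
  fixes Z :: int
  assumes "fact k dvd Z" "i < k" "j < k" "i \<noteq> j"
  shows "coprime (1 + (int i + 1) * Z) (1 + (int j + 1) * Z)"
proof -
  have less: "coprime (1 + (int i + 1) * Z) (1 + (int j + 1) * Z)" if ij: "i < j" "j < k" for i j
  proof (rule coprimeI)
    fix c assume c: "c dvd 1 + (int i + 1) * Z" "c dvd 1 + (int j + 1) * Z"
    then have "c dvd (int j + 1) * (1 + (int i + 1) * Z) - (int i + 1) * (1 + (int j + 1) * Z)"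
      by (intro dvd_diff dvd_mult)
    then have "c dvd int (j - i)" using ij by (simp add: algebra_simps of_nat_diff)
    moreover have "int (j - i) dvd fact k"
    proof -
      have "(j - i) dvd fact k" using ij by (intro dvd_fact) auto
      then show ?thesis by (metis of_nat_dvd_iff of_nat_fact)
    qed
    ultimately have "c dvd (int i + 1) * Z" using assms(1) by (meson dvd_mult dvd_trans)
    then show "is_unit c" using c(1) by (metis dvd_add_left_iff)
  qed
  consider "i < j" | "j < i" using assms(4) by linarith
  then show ?thesis
  proof cases
    case 1 then show ?thesis using less assms by blast
  next
    case 2 then show ?thesis using less assms coprime_commute by blast
  qed
qed

text \<open>This is \<open>P * (1 + k * Z) ^ R\<close> with \<open>P = 2 * (k + R)\<close> and
  \<open>Z = P * fact k * z\<close>; \<open>1 + k * Z\<close> is the largest of the moduli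
  \<open>1 + (j + 1) * Z\<close>.\<close>

definition gap_bound :: "nat \<Rightarrow> nat \<Rightarrow> nat \<Rightarrow> nat" where
  "gap_bound k R z = 2 * (k + R) * (1 + k * (2 * (k + R) * fact k * z)) ^ R"

lemma cylinder_exists:
  assumes "0 < R" "R < k" "0 < z"
  obtains P p where "cylinder k R P p" "\<And>g. g < k \<Longrightarrow> cylinder.gapmod k R P p g \<le> int (gap_bound k R z)"
    "2 * (int k + int R) * int z ^ k \<le> cylinder.period k P p"
proof -
  define P where "P = 2 * (int k + int R)"
  \<comment> \<open>The factor \<open>fact k\<close> makes the moduli pairwise coprime,
    \<open>P\<close> makes them coprime to \<open>P\<close>, and \<open>z\<close> controls their
    size.\<close>
  define Z where "Z = P * fact k * int z"
  define p where "p j = 1 + (int j + 1) * Z" for j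
  have P: "0 < P" using assms by (simp add: P_def)
  have Z: "0 < Z" using assms P by (simp add: Z_def)
  have z_le: "int z \<le> Z"
  proof -
    have "1 * int z \<le> (P * fact k) * int z"
      using P assms by (intro mult_right_mono) (simp_all add: int_one_le_iff_zero_less)
    then show ?thesis by (simp add: Z_def)
  qed
  have cyl: "cylinder k R P p"
  proof
    show "0 < p j" for j using Z by (simp add: p_def add_pos_nonneg)
    show "coprime P (p j)" for j
    proof (rule coprimeI)
      fix c assume c: "c dvd P" "c dvd p j"
      then have "c dvd (int j + 1) * Z" by (simp add: Z_def)
      then show "is_unit c" using c(2) unfolding p_def by (metis dvd_add_left_iff)
    qed
    show "coprime (p i) (p j)" if "i < k" "j < k" "i \<noteq> j" for i j
      unfolding p_def using that by (intro coprime_beta[of k]) (auto simp: Z_def)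
  qed (use assms in \<open>auto simp: P_def\<close>)
  interpret cylinder k R P p by (rule cyl)
  have "gapmod g \<le> int (gap_bound k R z)" if g: "g < k" for g
  proof -
    let ?J = "{j. j < k \<and> g \<in> arc j}"
    \<comment> \<open>Only the arcs that begin at \<open>g\<close> or at one of the
      \<open>R - 1\<close> gaps before it contain \<open>g\<close>.\<close>
    have "?J \<subseteq> (\<lambda>x. (g + k - x) mod k) ` {..<R}"
    proof
      fix j assume "j \<in> ?J"
      then obtain x where j: "j < k" and x: "x < R" "g = (j + x) mod k" by (auto simp: arc_def)
      have "(g + (k - x)) mod k = (j + x + (k - x)) mod k" unfolding x(2) by (rule mod_add_left_eq)
      moreover have "j + x + (k - x) = j + k" "g + (k - x) = g + k - x" using x assms by auto
      ultimately have "(g + k - x) mod k = j" using j by simp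
      then show "j \<in> (\<lambda>x. (g + k - x) mod k) ` {..<R}" using x by blast
    qed
    then have card: "card ?J \<le> R" using surj_card_le[of "{..<R}"] by simp
    have bound: "0 \<le> p j \<and> p j \<le> 1 + int k * Z" if "j \<in> ?J" for j
    proof -
      have "(int j + 1) * Z \<le> int k * Z" using that Z by (intro mult_right_mono) auto
      moreover have "0 \<le> (int j + 1) * Z" using Z by simp
      ultimately show ?thesis by (simp add: p_def)
    qed
    have "(\<Prod>j\<in>?J. p j) \<le> (\<Prod>j\<in>?J. 1 + int k * Z)"
      using bound by (intro prod_mono) auto
    also have "\<dots> = (1 + int k * Z) ^ card ?J" by simp
    also have "\<dots> \<le> (1 + int k * Z) ^ R" using card Z by (intro power_increasing) auto
    finally have "P * (\<Prod>j\<in>?J. p j) \<le> P * (1 + int k * Z) ^ R" using P by (intro mult_left_mono) auto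
    also have "\<dots> = int (gap_bound k R z)"
      by (simp add: gap_bound_def P_def Z_def mult_ac)
    finally show ?thesis by (simp add: gapmod_def)
  qed
  moreover have "P * int z ^ k \<le> period"
  proof -
    have "(\<Prod>j<k. int z) \<le> (\<Prod>j<k. p j)"
    proof (rule prod_mono)
      fix j
      have "1 * Z \<le> (int j + 1) * Z" using Z by (intro mult_right_mono) auto
      then show "0 \<le> int z \<and> int z \<le> p j" using z_le by (simp add: p_def)
    qed
    then show ?thesis unfolding period_def using P by (intro mult_left_mono) auto
  qed
  ultimately show ?thesis using that[of P p] cyl by (simp add: P_def)
qed

section \<open>Formulas with exactly \<open>N\<close> variables\<close>

lemma tradeoff_formula:
  assumes "0 < R" "R < k" "2 \<le> b" "0 < z" and N: "2 * b * k * gap_bound k R z \<le> N"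
  shows "\<exists>F :: nat cnf. is_cnf F \<and> \<not> satisfiable F \<and> card (cnf_vars F) = N \<and>
    min_width F \<le> b * (k + 4) \<and>
    cnf_size F \<le> k * gap_bound k R z * (b * 4 * 2 ^ (b * 4)) + 2 * (b * k * 2 ^ (b * k)) + N \<and>
    (\<forall>\<pi>. refutation F \<pi> \<and> treelike \<pi> \<and> ref_width \<pi> < (b - 1) * (k + R - 1) \<longrightarrow>
      2 ^ (z ^ k div 2) - 1 \<le> ref_size \<pi>)"
proof -
  obtain P p where cyl: "cylinder k R P p"
    and gap: "\<And>g. g < k \<Longrightarrow> cylinder.gapmod k R P p g \<le> int (gap_bound k R z)"
    and period: "2 * (int k + int R) * int z ^ k \<le> cylinder.period k P p"
    using cylinder_exists[OF assms(1,2,4)] by blast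
  interpret cylinder k R P p by (rule cyl)
  \<comment> \<open>Unit clauses on fresh variables supply the missing variables.\<close>
  define n where "n = N - card (cnf_vars (base_cnf b))"
  have vars: "card (cnf_vars (base_cnf b)) + n = N"
    using card_base_vars_le[OF gap, of b] N by (simp add: n_def)
  have "2 * int (slack * (z ^ k div 2)) \<le> half"
  proof -
    have "2 * (slack * (z ^ k div 2)) \<le> slack * z ^ k" by simp
    also have "\<dots> \<le> (k + R) * z ^ k" by (intro mult_le_mono1) (simp add: slack_def)
    finally have "2 * int (slack * (z ^ k div 2)) \<le> (int k + int R) * int z ^ k"
      by (metis (mono_tags) of_nat_add of_nat_mult of_nat_numeral of_nat_power of_nat_le_iff)
    also have "\<dots> \<le> half" using period unfolding half_def by linarith
    finally show ?thesis .
  qed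
  then have "\<forall>\<pi>. refutation (formula b n) \<pi> \<and> treelike \<pi> \<and> ref_width \<pi> < (b - 1) * (k + R - 1) \<longrightarrow>
      2 ^ (z ^ k div 2) - 1 \<le> ref_size \<pi>"
    using treelike_size_formula[OF assms(3)] unfolding slack_def by blast
  moreover have "cnf_size (formula b n) \<le>
      k * gap_bound k R z * (b * 4 * 2 ^ (b * 4)) + 2 * (b * k * 2 ^ (b * k)) + N"
    using cnf_size_formula_le[OF gap, of b n] vars by linarith
  ultimately show ?thesis
    using is_cnf_formula formula_unsatisfiable min_width_formula card_vars_formula[of b n] vars
    by (intro exI[of _ "formula b n"]) auto
qed

text \<open>Stands in wherever the parameters do not fit, which happens only for small
  \<open>N\<close>.\<close>

lemma trivial_formula:
  "\<exists>F :: nat cnf. is_cnf F \<and> \<not> satisfiable F \<and> card (cnf_vars F) = N"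
proof -
  let ?F = "insert {} ((\<lambda>i. {Pos i}) ` {..<N}) :: nat cnf"
  have "is_cnf ?F" by (auto simp: is_cnf_def is_clause_def)
  moreover have "\<not> satisfiable ?F" by (auto simp: satisfiable_def)
  moreover have "cnf_vars ?F = {..<N}" by (auto simp: cnf_vars_def)
  ultimately show ?thesis by (metis card_lessThan)
qed

lemma tradeoff_family:
  assumes ev: "\<forall>\<^sub>F N in sequentially. 0 < R \<and> R < k N \<and> 2 \<le> b N \<and> 0 < z N \<and>
    2 * b N * k N * gap_bound (k N) R (z N) \<le> N"
  shows "\<exists>F :: nat \<Rightarrow> nat cnf.
    (\<forall>N. is_cnf (F N) \<and> \<not> satisfiable (F N) \<and> card (cnf_vars (F N)) = N) \<and>
    (\<forall>\<^sub>F N in sequentially. min_width (F N) \<le> b N * (k N + 4) \<and>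
      cnf_size (F N) \<le> k N * gap_bound (k N) R (z N) * (b N * 4 * 2 ^ (b N * 4)) +
        2 * (b N * k N * 2 ^ (b N * k N)) + N \<and>
      (\<forall>\<pi>. refutation (F N) \<pi> \<and> treelike \<pi> \<and> ref_width \<pi> < (b N - 1) * (k N + R - 1) \<longrightarrow>
        2 ^ (z N ^ k N div 2) - 1 \<le> ref_size \<pi>))"
proof -
  let ?c = "\<lambda>N. 0 < R \<and> R < k N \<and> 2 \<le> b N \<and> 0 < z N \<and> 2 * b N * k N * gap_bound (k N) R (z N) \<le> N"
  let ?p = "\<lambda>N F. min_width F \<le> b N * (k N + 4) \<and>
      cnf_size F \<le> k N * gap_bound (k N) R (z N) * (b N * 4 * 2 ^ (b N * 4)) +
        2 * (b N * k N * 2 ^ (b N * k N)) + N \<and>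
      (\<forall>\<pi>. refutation F \<pi> \<and> treelike \<pi> \<and> ref_width \<pi> < (b N - 1) * (k N + R - 1) \<longrightarrow>
        2 ^ (z N ^ k N div 2) - 1 \<le> ref_size \<pi>)"
  have "\<forall>N. \<exists>F :: nat cnf. is_cnf F \<and> \<not> satisfiable F \<and> card (cnf_vars F) = N \<and> (?c N \<longrightarrow> ?p N F)"
  proof
    fix N
    show "\<exists>F :: nat cnf. is_cnf F \<and> \<not> satisfiable F \<and> card (cnf_vars F) = N \<and> (?c N \<longrightarrow> ?p N F)"
    proof (cases "?c N")
      case True
      then show ?thesis using tradeoff_formula[of R "k N" "b N" "z N" N] by blast
    next
      case False
      then show ?thesis using trivial_formula[of N] by blast
    qed
  qed
  then obtain F :: "nat \<Rightarrow> nat cnf" where F: "\<And>N. is_cnf (F N) \<and> \<not> satisfiable (F N) \<and>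
    card (cnf_vars (F N)) = N \<and> (?c N \<longrightarrow> ?p N (F N))" by metis
  then have "\<forall>\<^sub>F N in sequentially. ?p N (F N)"
    using ev by (elim eventually_mono) blast
  then show ?thesis using F by (intro exI[of _ F]) blast
qed

text \<open>The extra \<open>1\<close> in the exponent pays for the subtraction, as
  \<open>exp (y + 1)\<close> is at least \<open>2 * exp y\<close>; the \<open>- 1\<close> pays for
  rounding in \<open>n div 2\<close>.\<close>

lemma exp_le_two_power:
  assumes "y + 1 \<le> (real n / 2 - 1) * ln 2" "0 \<le> y"
  shows "exp y \<le> real (2 ^ (n div 2) - 1)"
proof -
  have "real n / 2 - 1 \<le> real (n div 2)" by linarith
  then have "(real n / 2 - 1) * ln 2 \<le> real (n div 2) * ln 2" by (intro mult_right_mono) auto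
  then have "exp (y + 1) \<le> exp (real (n div 2) * ln 2)" using assms by (subst exp_le_cancel_iff) linarith
  also have "\<dots> = 2 ^ (n div 2)" by (simp add: exp_of_nat_mult)
  finally have "exp y * exp 1 \<le> 2 ^ (n div 2)" by (simp add: exp_add)
  moreover have "exp y * 2 \<le> exp y * exp 1" using exp_ge_add_one_self[of 1] by (intro mult_left_mono) auto
  moreover have "1 \<le> exp y" using assms(2) by simp
  ultimately have "exp y \<le> 2 ^ (n div 2) - 1" by linarith
  then show ?thesis by (simp add: of_nat_diff)
qed

lemma gap_bound_le:
  assumes "0 < z"
  shows "gap_bound k R z \<le> gap_bound k R 1 * z ^ R"
proof -
  let ?x = "k * (2 * (k + R) * fact k)"
  have "1 + ?x * z \<le> (1 + ?x) * z" using assms by (simp add: algebra_simps)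
  then have "(1 + ?x * z) ^ R \<le> ((1 + ?x) * z) ^ R" by (rule power_mono) simp
  then have "2 * (k + R) * (1 + ?x * z) ^ R \<le> 2 * (k + R) * ((1 + ?x) * z) ^ R" by (rule mult_le_mono2)
  moreover have "2 * (k + R) * ((1 + ?x) * z) ^ R = gap_bound k R 1 * z ^ R"
    unfolding gap_bound_def power_mult_distrib by (simp only: mult.assoc mult_1_right)
  ultimately show ?thesis unfolding gap_bound_def by (simp only: mult.assoc)
qed

subsection \<open>Constant width\<close>

text \<open>The depth of the formulas grows like the \<open>k/R\<close>-th power of their size, and \<open>k/R = 17/7 > 2.4\<close>.
  For large \<open>b\<close> and \<open>k\<close> the ratio of the two widths in the last assumption is close to
  \<open>(k + R)/k = 24/17 > 1.4\<close>.\<close>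

lemma constant_width_tradeoff:
  fixes k R b :: nat
  assumes kR: "0 < R" "7 * k = 17 * R" and b: "2 \<le> b"
    and width: "14 * (b * (k + 4)) < 10 * ((b - 1) * (k + R - 1))"
  shows "\<exists>F :: nat \<Rightarrow> nat cnf.
        unsat_family F \<and>
        (\<lambda>N. real (min_width (F N))) \<in> o(\<lambda>N. ln (real N)) \<and>
        (\<forall>\<^sub>F N in sequentially. \<forall>\<pi>.
           refutation (F N) \<pi> \<and> treelike \<pi> \<and>
           real (ref_width \<pi>) \<le> 1.4 * real (min_width (F N)) \<longrightarrow>
           real (ref_size \<pi>) \<ge> exp (real (cnf_size (F N)) powr 2.4))"
proof -
  define K where "K = 2 * b * k * gap_bound k R 1"
  \<comment> \<open>The largest \<open>z\<close> with \<open>K * z ^ R \<le> N\<close>.\<close>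
  define z where "z N = nat \<lfloor>(real N / real K) powr (1 / real R)\<rfloor>" for N
  define C where "C = real (2 * 2 ^ (b * 4) + 2 * (b * k * 2 ^ (b * k)) + 1)"
  define c where "c = (1 / 2) ^ k / real K powr (17 / 7)"
  have k: "R < k" using kR by linarith
  have K: "0 < K" using kR k b by (simp add: K_def gap_bound_def)
  have C: "0 < C" unfolding C_def of_nat_0_less_iff by simp
  have c: "0 < c" using K by (simp add: c_def)
  have ratio: "real k / real R = 17 / 7"
  proof -
    have "7 * real k = 17 * real R" using kR(2) by linarith
    then show ?thesis using kR(1) by (simp add: field_simps)
  qed
  have z_le: "K * z N ^ R \<le> N" for N
  proof -
    have "real (z N) \<le> (real N / real K) powr (1 / real R)" by (simp add: z_def)
    then have "real (z N) ^ R \<le> ((real N / real K) powr (1 / real R)) ^ R" by (rule power_mono) simp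
    also have "\<dots> = real N / real K"
      using kR(1) K by (cases "N = 0") (simp_all add: powr_power)
    finally have "real K * real (z N) ^ R \<le> real N" using K by (simp add: field_simps)
    then show ?thesis by (metis of_nat_le_iff of_nat_mult of_nat_power)
  qed
  have vars_le: "2 * b * k * gap_bound k R (z N) \<le> N" if "0 < z N" for N
  proof -
    have "2 * b * k * gap_bound k R (z N) \<le> 2 * b * k * (gap_bound k R 1 * z N ^ R)"
      by (intro mult_le_mono2 gap_bound_le that)
    also have "\<dots> = K * z N ^ R" by (simp only: K_def mult.assoc)
    finally show ?thesis using z_le le_trans by blast
  qed
  \<comment> \<open>Once the root is at least \<open>2\<close>, rounding it down loses at most a
    factor \<open>2\<close>.\<close>
  have z_ge: "\<forall>\<^sub>F N in sequentially. (real N / real K) powr (1 / real R) / 2 \<le> real (z N) \<and> 0 < z N"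
  proof -
    show ?thesis
      using eventually_ge_at_top[of "2 ^ R * K"]
    proof eventually_elim
      case (elim N)
      then have "real (2 ^ R * K) \<le> real N" by (rule of_nat_mono)
      then have "2 ^ R \<le> real N / real K" using K by (simp add: field_simps)
      then have "(2 ^ R) powr (1 / real R) \<le> (real N / real K) powr (1 / real R)"
        by (intro powr_mono2) auto
      moreover have "(2 ^ R :: real) powr (1 / real R) = 2"
        using kR(1) by (simp add: powr_powr flip: powr_realpow)
      ultimately show ?case unfolding z_def by linarith
    qed
  qed
  obtain F :: "nat \<Rightarrow> nat cnf" where
    F: "\<And>N. is_cnf (F N) \<and> \<not> satisfiable (F N) \<and> card (cnf_vars (F N)) = N" and
    ev: "\<forall>\<^sub>F N in sequentially. min_width (F N) \<le> b * (k + 4) \<and>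
      cnf_size (F N) \<le> k * gap_bound k R (z N) * (b * 4 * 2 ^ (b * 4)) +
        2 * (b * k * 2 ^ (b * k)) + N \<and>
      (\<forall>\<pi>. refutation (F N) \<pi> \<and> treelike \<pi> \<and> ref_width \<pi> < (b - 1) * (k + R - 1) \<longrightarrow>
        2 ^ (z N ^ k div 2) - 1 \<le> ref_size \<pi>)"
  proof -
    have "\<forall>\<^sub>F N in sequentially. 0 < R \<and> R < k \<and> 2 \<le> b \<and> 0 < z N \<and> 2 * b * k * gap_bound k R (z N) \<le> N"
      using z_ge by eventually_elim (use kR k b vars_le in blast)
    then show ?thesis using tradeoff_family[of R "\<lambda>_. k" "\<lambda>_. b" z] that by blast
  qed
  have size: "\<forall>\<^sub>F N in sequentially. real (cnf_size (F N)) \<le> C * real N"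
    using ev z_ge eventually_ge_at_top[of 1]
  proof eventually_elim
    case (elim N)
    have "k * gap_bound k R (z N) * (b * 4 * 2 ^ (b * 4)) =
        (2 * b * k * gap_bound k R (z N)) * (2 * 2 ^ (b * 4))" by (simp add: mult_ac)
    also have "\<dots> \<le> N * (2 * 2 ^ (b * 4))" using vars_le elim by (intro mult_le_mono1) blast
    finally have "cnf_size (F N) \<le> N * (2 * 2 ^ (b * 4)) + 2 * (b * k * 2 ^ (b * k)) + N"
      using elim by linarith
    also have "\<dots> \<le> N * (2 * 2 ^ (b * 4)) + N * (2 * (b * k * 2 ^ (b * k))) + N"
      using elim by simp
    also have "\<dots> = (2 * 2 ^ (b * 4) + 2 * (b * k * 2 ^ (b * k)) + 1) * N"
      by (simp add: algebra_simps)
    finally have "real (cnf_size (F N)) \<le> real ((2 * 2 ^ (b * 4) + 2 * (b * k * 2 ^ (b * k)) + 1) * N)"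
      by (rule of_nat_mono)
    then show ?case by (simp only: C_def of_nat_mult)
  qed
  have depth: "\<forall>\<^sub>F N in sequentially. c * real N powr (17 / 7) \<le> real (z N ^ k)"
    using z_ge eventually_gt_at_top[of 0]
  proof eventually_elim
    case (elim N)
    have "c * real N powr (17 / 7) = ((real N / real K) powr (1 / real R) / 2) ^ k"
      using elim K by (simp add: c_def powr_power ratio power_divide powr_divide)
    also have "\<dots> \<le> real (z N) ^ k" using elim by (intro power_mono) auto
    finally show ?case by simp
  qed
  have growth: "\<forall>\<^sub>F N in sequentially.
      (C * real N) powr 2.4 + 1 \<le> (c * real N powr (17 / 7) / 2 - 1) * ln 2"
    using C c by real_asymp
  have "\<forall>\<^sub>F N in sequentially. \<forall>\<pi>. refutation (F N) \<pi> \<and> treelike \<pi> \<and>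
      real (ref_width \<pi>) \<le> 1.4 * real (min_width (F N)) \<longrightarrow>
      real (ref_size \<pi>) \<ge> exp (real (cnf_size (F N)) powr 2.4)"
    using ev size depth growth
  proof eventually_elim
    case (elim N)
    show ?case
    proof (intro allI impI, elim conjE)
      fix \<pi> assume \<pi>: "refutation (F N) \<pi>" "treelike \<pi>"
        "real (ref_width \<pi>) \<le> 1.4 * real (min_width (F N))"
      have "real (min_width (F N)) \<le> real (b * (k + 4))" using elim(1) by (intro of_nat_mono) blast
      moreover have "14 * real (b * (k + 4)) < 10 * real ((b - 1) * (k + R - 1))" using width by linarith
      ultimately have "real (ref_width \<pi>) < real ((b - 1) * (k + R - 1))" using \<pi>(3) by linarith
      then have "ref_width \<pi> < (b - 1) * (k + R - 1)" by (rule of_nat_less_imp_less)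
      then have ge: "2 ^ (z N ^ k div 2) - 1 \<le> ref_size \<pi>" using elim(1) \<pi>(1,2) by blast
      have "real (cnf_size (F N)) powr 2.4 \<le> (C * real N) powr 2.4"
        using elim(2) by (intro powr_mono2) auto
      moreover have "(c * real N powr (17 / 7) / 2 - 1) * ln 2 \<le> (real (z N ^ k) / 2 - 1) * ln 2"
        using elim(3) by (intro mult_right_mono) auto
      ultimately have "exp (real (cnf_size (F N)) powr 2.4) \<le> real (2 ^ (z N ^ k div 2) - 1)"
        using elim(4) by (intro exp_le_two_power) (linarith, simp)
      also have "\<dots> \<le> real (ref_size \<pi>)" using ge by (rule of_nat_mono)
      finally show "exp (real (cnf_size (F N)) powr 2.4) \<le> real (ref_size \<pi>)" .
    qed
  qed
  moreover have "unsat_family F"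
    unfolding unsat_family_def
  proof (intro conjI exI[of _ 1])
    show "(\<lambda>N. real (cnf_size (F N))) \<in> O(\<lambda>N. real N ^ 1)"
      using size by (intro bigoI[of _ C]) (auto elim: eventually_mono)
  qed (use F in blast)
  moreover have "(\<lambda>N. real (min_width (F N))) \<in> o(\<lambda>N. ln (real N))"
  proof (rule landau_o.big_small_trans)
    show "(\<lambda>N. real (min_width (F N))) \<in> O(\<lambda>_. real (b * (k + 4)))"
      using ev by (intro bigoI[of _ 1]) (auto elim!: eventually_mono simp del: of_nat_mult)
    show "(\<lambda>_. real (b * (k + 4))) \<in> o(\<lambda>N. ln (real N))" by real_asymp
  qed
  ultimately show ?thesis by blast
qed

subsection \<open>Slowly growing width\<close>

text \<open>Here \<open>R = 8\<close> stays fixed, so that the exponent \<open>k/R\<close> tends to infinity; \<open>b k\<close> must stay below a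
  small multiple of \<open>ln N\<close>, as the two ring equations have \<open>2 ^ (b k)\<close> clauses each.\<close>

lemma width_plus_tradeoff:
  "\<exists>F :: nat \<Rightarrow> nat cnf.
        unsat_family F \<and>
        (\<lambda>N. real (min_width (F N))) \<in> o(\<lambda>N. ln (real N) powr (3/2)) \<and>
        (\<exists>g :: nat \<Rightarrow> real. filterlim g at_top sequentially \<and>
          (\<forall>\<^sub>F N in sequentially. \<forall>\<pi>.
             refutation (F N) \<pi> \<and> treelike \<pi> \<and>
             real (ref_width \<pi>) \<le>
               real (min_width (F N)) + 40 * (ln (real N) / ln (ln (real N))) \<longrightarrow>
             real (ref_size \<pi>) \<ge> exp (real (cnf_size (F N)) powr g N)))"
proof -
  define l where "l N = ln (real N)" for N :: nat
  define ll where "ll N = ln (ln (real N))" for N :: nat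
  \<comment> \<open>\<open>9\<close> secures \<open>R < k\<close>, and the divisor
    \<open>1000\<close> keeps \<open>b * k\<close> below \<open>l N / 10\<close>.\<close>
  define k where "k N = 9 + nat \<lfloor>ll N / 1000\<rfloor>" for N
  \<comment> \<open>The width bounds differ by
    \<open>(b - 1) * (k + 7) - b * (k + 4) = 3 * b - k - 7\<close>, where \<open>3 * b\<close> is at
    least \<open>240 * l N / ll N\<close>.\<close>
  define b where "b N = nat \<lceil>80 * l N / ll N\<rceil>" for N
  define z where "z N = nat \<lfloor>real N powr (1 / 100)\<rfloor>" for N
  \<comment> \<open>The size is at most \<open>N ^ 3\<close>, and \<open>z ^ k\<close> is at least
    \<open>N powr (k / 200)\<close>, the fifth power of \<open>N powr g N\<close>; the fifth power
    beats the cube.\<close>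
  define g where "g N = real (k N) / 1000" for N
  have k9: "9 \<le> k N" for N by (simp add: k_def)
  have k_bounds: "\<forall>\<^sub>F N in sequentially. ll N / 1000 \<le> real (k N) \<and> real (k N) \<le> 9 + ll N / 1000 \<and>
      9 + ll N / 1000 \<le> ll N"
  proof -
    have "\<forall>\<^sub>F N in sequentially. 0 \<le> ll N" unfolding ll_def by real_asymp
    moreover have "\<forall>\<^sub>F N in sequentially. 9 + ll N / 1000 \<le> ll N" unfolding ll_def by real_asymp
    ultimately show ?thesis by eventually_elim (simp add: k_def; linarith)
  qed
  have b_bounds: "\<forall>\<^sub>F N in sequentially. 80 * l N / ll N \<le> real (b N) \<and> real (b N) \<le> 80 * l N / ll N + 1 \<and>
      2 \<le> b N"
  proof -
    have "\<forall>\<^sub>F N in sequentially. 2 \<le> 80 * l N / ll N" unfolding l_def ll_def by real_asymp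
    then show ?thesis by eventually_elim (simp add: b_def; linarith)
  qed
  have z_bounds: "\<forall>\<^sub>F N in sequentially. real N powr (1 / 200) \<le> real (z N) \<and>
      real (z N) \<le> real N powr (1 / 100) \<and> 0 < z N"
  proof -
    have "\<forall>\<^sub>F N in sequentially. real N powr (1 / 200) \<le> real N powr (1 / 100) - 1" by real_asymp
    moreover have "\<forall>\<^sub>F N in sequentially. 1 \<le> real N powr (1 / 100)" by real_asymp
    ultimately show ?thesis by eventually_elim (simp add: z_def; linarith)
  qed
  have vars: "\<forall>\<^sub>F N in sequentially. 2 * b N * k N * gap_bound (k N) 8 (z N) \<le> N"
  proof -
    \<comment> \<open>The factorial of \<open>k\<close> is at most \<open>ll N powr ll N\<close>,
      which is subpolynomial in \<open>N\<close>; the eighth power of \<open>z\<close> contributes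
      only \<open>N powr (8 / 100)\<close>.\<close>
    have "\<forall>\<^sub>F N in sequentially. 2 * (80 * l N / ll N + 1) * ll N *
        (2 * (ll N + 8) * (1 + ll N * (2 * (ll N + 8) * (ll N powr ll N) * real N powr (1 / 100))) ^ 8) \<le> real N"
      unfolding l_def ll_def by real_asymp
    moreover have "\<forall>\<^sub>F N in sequentially. 1 \<le> ll N" unfolding ll_def by real_asymp
    moreover have "\<forall>\<^sub>F N in sequentially. 0 \<le> 80 * l N / ll N" unfolding l_def ll_def by real_asymp
    ultimately show ?thesis using k_bounds b_bounds z_bounds
    proof eventually_elim
      case (elim N)
      have "real (fact (k N)) \<le> real (k N ^ k N)" unfolding of_nat_fact by (rule fact_le_power)
      also have "\<dots> = real (k N) powr real (k N)" using k9[of N] by (simp add: powr_realpow)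
      also have "\<dots> \<le> real (k N) powr ll N" using elim k9[of N] by (intro powr_mono) linarith+
      also have "\<dots> \<le> ll N powr ll N" using elim by (intro powr_mono2) auto
      finally have fact: "real (fact (k N)) \<le> ll N powr ll N" .
      have kl: "real (k N) \<le> ll N" using elim by linarith
      have "real (2 * b N * k N * gap_bound (k N) 8 (z N)) = 2 * real (b N) * real (k N) *
          (2 * (real (k N) + 8) * (1 + real (k N) * (2 * (real (k N) + 8) * real (fact (k N)) * real (z N))) ^ 8)"
        by (simp add: gap_bound_def)
      also have "\<dots> \<le> 2 * (80 * l N / ll N + 1) * ll N *
        (2 * (ll N + 8) * (1 + ll N * (2 * (ll N + 8) * (ll N powr ll N) * real N powr (1 / 100))) ^ 8)"
      proof -
        have ll: "0 \<le> ll N" using elim by simp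
        have 1: "2 * (real (k N) + 8) * real (fact (k N)) * real (z N) \<le>
            2 * (ll N + 8) * (ll N powr ll N) * real N powr (1 / 100)"
          using elim kl by (intro mult_mono fact) auto
        have 2: "real (k N) * (2 * (real (k N) + 8) * real (fact (k N)) * real (z N)) \<le>
            ll N * (2 * (ll N + 8) * (ll N powr ll N) * real N powr (1 / 100))"
          by (rule mult_mono[OF kl 1 ll]) simp
        have 3: "(1 + real (k N) * (2 * (real (k N) + 8) * real (fact (k N)) * real (z N))) ^ 8 \<le>
            (1 + ll N * (2 * (ll N + 8) * (ll N powr ll N) * real N powr (1 / 100))) ^ 8"
          using 2 by (intro power_mono add_left_mono) simp_all
        have 4: "2 * real (b N) * real (k N) \<le> 2 * (80 * l N / ll N + 1) * ll N"
          using elim kl by (intro mult_mono) auto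
        have 5: "2 * (real (k N) + 8) * (1 + real (k N) * (2 * (real (k N) + 8) * real (fact (k N)) * real (z N))) ^ 8 \<le>
            2 * (ll N + 8) * (1 + ll N * (2 * (ll N + 8) * (ll N powr ll N) * real N powr (1 / 100))) ^ 8"
          using kl ll by (intro mult_mono[OF _ 3]) simp_all
        show ?thesis
        proof (rule mult_mono[OF 4 5])
          show "0 \<le> 2 * (80 * l N / ll N + 1) * ll N"
            using elim(3) ll by (intro mult_nonneg_nonneg) simp_all
        qed simp
      qed
      also have "\<dots> \<le> real N" using elim by blast
      finally show ?case by (simp only: of_nat_le_iff)
    qed
  qed
  obtain F :: "nat \<Rightarrow> nat cnf" where
    F: "\<And>N. is_cnf (F N) \<and> \<not> satisfiable (F N) \<and> card (cnf_vars (F N)) = N" and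
    ev: "\<forall>\<^sub>F N in sequentially. min_width (F N) \<le> b N * (k N + 4) \<and>
      cnf_size (F N) \<le> k N * gap_bound (k N) 8 (z N) * (b N * 4 * 2 ^ (b N * 4)) +
        2 * (b N * k N * 2 ^ (b N * k N)) + N \<and>
      (\<forall>\<pi>. refutation (F N) \<pi> \<and> treelike \<pi> \<and> ref_width \<pi> < (b N - 1) * (k N + 8 - 1) \<longrightarrow>
        2 ^ (z N ^ k N div 2) - 1 \<le> ref_size \<pi>)"
  proof -
    have "\<forall>\<^sub>F N in sequentially. 0 < (8::nat) \<and> 8 < k N \<and> 2 \<le> b N \<and> 0 < z N \<and>
        2 * b N * k N * gap_bound (k N) 8 (z N) \<le> N"
      using b_bounds z_bounds vars
    proof eventually_elim
      case (elim N)
      then show ?case using k9[of N] by simp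
    qed
    then show ?thesis using tradeoff_family[of 8 k b z] that by blast
  qed
  have size: "\<forall>\<^sub>F N in sequentially. real (cnf_size (F N)) \<le> real N ^ 3"
  proof -
    have "\<forall>\<^sub>F N in sequentially. 2 powr ((80 * l N / ll N + 1) * 4) \<le> real N"
      unfolding l_def ll_def by real_asymp
    moreover have "\<forall>\<^sub>F N in sequentially. (80 * l N / ll N + 1) * (9 + ll N / 1000) \<le> l N / 10"
      unfolding l_def ll_def by real_asymp
    moreover have "\<forall>\<^sub>F N in sequentially. l N / 10 * exp (l N / 10) \<le> real N"
      unfolding l_def by real_asymp
    ultimately show ?thesis using ev vars k_bounds b_bounds eventually_ge_at_top[of 4]
    proof eventually_elim
      case (elim N)
      have "real (2 ^ (b N * 4)) = 2 powr (real (b N) * 4)"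
        by (simp flip: powr_realpow)
      also have "\<dots> \<le> 2 powr ((80 * l N / ll N + 1) * 4)" using elim by (intro powr_mono) auto
      also have "\<dots> \<le> real N" using elim by blast
      finally have 1: "2 ^ (b N * 4) \<le> N" by (simp only: of_nat_le_iff)
      have "real (b N) * real (k N) \<le> (80 * l N / ll N + 1) * (9 + ll N / 1000)"
        using elim by (intro mult_mono) auto
      then have bk: "real (b N) * real (k N) \<le> l N / 10" using elim(2) by linarith
      have "real (b N * k N * 2 ^ (b N * k N)) = (real (b N) * real (k N)) * 2 powr (real (b N) * real (k N))"
        by (simp flip: powr_realpow)
      also have "\<dots> \<le> l N / 10 * exp (l N / 10)"
      proof (rule mult_mono[OF bk])
        have "2 powr (real (b N) * real (k N)) = exp (real (b N) * real (k N) * ln 2)"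
          by (simp add: powr_def)
        also have "\<dots> \<le> exp (real (b N) * real (k N) * 1)"
          by (subst exp_le_cancel_iff, intro mult_left_mono) (auto simp: ln_2_less_1 less_imp_le)
        also have "\<dots> \<le> exp (l N / 10)" using bk by (subst exp_le_cancel_iff) simp
        finally show "2 powr (real (b N) * real (k N)) \<le> exp (l N / 10)" .
        show "0 \<le> l N / 10" using bk by (rule order_trans[rotated]) simp
      qed simp
      also have "\<dots> \<le> real N" using elim by blast
      finally have 2: "b N * k N * 2 ^ (b N * k N) \<le> N" by (simp only: of_nat_le_iff)
      have "k N * gap_bound (k N) 8 (z N) * (b N * 4 * 2 ^ (b N * 4)) =
          (2 * b N * k N * gap_bound (k N) 8 (z N)) * (2 * 2 ^ (b N * 4))" by (simp add: mult_ac)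
      also have "\<dots> \<le> N * (2 * N)" using elim 1 by (intro mult_le_mono) auto
      finally have "cnf_size (F N) \<le> N * (2 * N) + 2 * N + N" using elim(4) 2 by linarith
      also have "\<dots> \<le> N * (2 * N) + N * N" using elim(8) by simp
      also have "\<dots> \<le> 4 * (N * N)" by simp
      also have "\<dots> \<le> N * (N * N)" using elim(8) by (rule mult_le_mono1)
      finally have "real (cnf_size (F N)) \<le> real (N * (N * N))" by (rule of_nat_mono)
      then show ?case by (simp add: power3_eq_cube)
    qed
  qed
  have width: "\<forall>\<^sub>F N in sequentially. real (b N * (k N + 4)) + 40 * (ln (real N) / ln (ln (real N))) <
      real ((b N - 1) * (k N + 8 - 1))"
  proof -
    have "\<forall>\<^sub>F N in sequentially. ll N + 7 < 200 * l N / ll N"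
      unfolding l_def ll_def by real_asymp
    then show ?thesis using k_bounds b_bounds
    proof eventually_elim
      case (elim N)
      have "real ((b N - 1) * (k N + 8 - 1)) = (real (b N) - 1) * (real (k N) + 7)"
        using elim by (simp add: of_nat_diff)
      also have "\<dots> = real (b N * (k N + 4)) + (3 * real (b N) - real (k N) - 7)"
        by (simp add: algebra_simps)
      finally have eq: "real ((b N - 1) * (k N + 8 - 1)) =
        real (b N * (k N + 4)) + (3 * real (b N) - real (k N) - 7)" .
      have "real (k N) + 7 < 200 * (l N / ll N)" "80 * (l N / ll N) \<le> real (b N)" using elim by auto
      then have "40 * (l N / ll N) < 3 * real (b N) - real (k N) - 7" by linarith
      then show ?case unfolding eq l_def ll_def by linarith
    qed
  qed
  have depth: "\<forall>\<^sub>F N in sequentially. (real N powr g N) ^ 3 + 1 \<le> (real (z N ^ k N) / 2 - 1) * ln 2"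
  proof -
    have "\<forall>\<^sub>F N in sequentially. 3 \<le> real N powr (1 / 1000)" by real_asymp
    then show ?thesis using z_bounds eventually_gt_at_top[of 1]
    proof eventually_elim
      case (elim N)
      define y where "y = real N powr g N"
      have "real N powr (1 / 1000) \<le> y"
        unfolding y_def using elim k9[of N] by (intro powr_mono) (auto simp: g_def)
      then have y: "3 \<le> y" using elim by linarith
      have "y ^ 5 = (real N powr (1 / 200)) ^ k N"
        using elim(3) by (simp add: y_def g_def powr_power)
      also have "\<dots> \<le> real (z N) ^ k N" using elim by (intro power_mono) auto
      finally have y5: "y ^ 5 \<le> real (z N ^ k N)" by simp
      have "9 * y ^ 3 \<le> y ^ 2 * y ^ 3"
        using y power_mono[of 3 y 2] by (intro mult_right_mono) auto
      also have "\<dots> = y ^ 5" by (simp flip: power_add)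
      finally have y53: "9 * y ^ 3 \<le> y ^ 5" .
      have y3: "27 \<le> y ^ 3" using power_mono[OF y, of 3] by simp
      have ln2: "1 / 2 \<le> ln (2::real)" using ln_le_minus_one[of "1 / 2 :: real"] by (simp add: ln_div)
      have "y ^ 3 + 1 \<le> (y ^ 5 / 2 - 1) * (1 / 2)" using y53 y3 by (simp add: field_simps)
      also have "\<dots> \<le> (y ^ 5 / 2 - 1) * ln 2"
        using ln2 y53 y3 by (intro mult_left_mono) auto
      also have "\<dots> \<le> (real (z N ^ k N) / 2 - 1) * ln 2"
        using y5 by (intro mult_right_mono) auto
      finally show ?case unfolding y_def .
    qed
  qed
  have "\<forall>\<^sub>F N in sequentially. \<forall>\<pi>. refutation (F N) \<pi> \<and> treelike \<pi> \<and>
      real (ref_width \<pi>) \<le> real (min_width (F N)) + 40 * (ln (real N) / ln (ln (real N))) \<longrightarrow>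
      real (ref_size \<pi>) \<ge> exp (real (cnf_size (F N)) powr g N)"
    using ev size width depth eventually_gt_at_top[of 0]
  proof eventually_elim
    case (elim N)
    show ?case
    proof (intro allI impI, elim conjE)
      fix \<pi> assume \<pi>: "refutation (F N) \<pi>" "treelike \<pi>"
        "real (ref_width \<pi>) \<le> real (min_width (F N)) + 40 * (ln (real N) / ln (ln (real N)))"
      have "real (min_width (F N)) \<le> real (b N * (k N + 4))" using elim(1) by (intro of_nat_mono) blast
      then have "real (ref_width \<pi>) < real ((b N - 1) * (k N + 8 - 1))" using \<pi>(3) elim(3) by linarith
      then have "ref_width \<pi> < (b N - 1) * (k N + 8 - 1)" by (rule of_nat_less_imp_less)
      then have ge: "2 ^ (z N ^ k N div 2) - 1 \<le> ref_size \<pi>" using elim(1) \<pi>(1,2) by blast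
      have "real (cnf_size (F N)) powr g N \<le> (real N ^ 3) powr g N"
        using elim(2) by (intro powr_mono2) (auto simp: g_def)
      also have "\<dots> = (real N powr g N) ^ 3"
      proof -
        have "real N ^ 3 = real N powr 3" using elim(5) by simp
        then have "(real N ^ 3) powr g N = real N powr (3 * g N)" by (simp only: powr_powr)
        moreover have "(real N powr g N) ^ 3 = real N powr (3 * g N)"
          using elim(5) by (simp add: powr_power mult.commute)
        ultimately show ?thesis by simp
      qed
      finally have "exp (real (cnf_size (F N)) powr g N) \<le> real (2 ^ (z N ^ k N div 2) - 1)"
        using elim(4) by (intro exp_le_two_power) (linarith, simp)
      also have "\<dots> \<le> real (ref_size \<pi>)" using ge by (rule of_nat_mono)
      finally show "exp (real (cnf_size (F N)) powr g N) \<le> real (ref_size \<pi>)" .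
    qed
  qed
  moreover have "filterlim g at_top sequentially"
  proof (rule filterlim_at_top_mono)
    show "filterlim (\<lambda>N. ll N / 1000 / 1000) at_top sequentially" unfolding ll_def by real_asymp
    show "\<forall>\<^sub>F N in sequentially. ll N / 1000 / 1000 \<le> g N"
      using k_bounds by eventually_elim (auto simp: g_def)
  qed
  moreover have "unsat_family F"
    unfolding unsat_family_def
  proof (intro conjI exI[of _ 3])
    show "(\<lambda>N. real (cnf_size (F N))) \<in> O(\<lambda>N. real N ^ 3)"
      using size by (intro bigoI[of _ 1]) (auto elim: eventually_mono)
  qed (use F in blast)
  moreover have "(\<lambda>N. real (min_width (F N))) \<in> o(\<lambda>N. ln (real N) powr (3/2))"
  proof (rule landau_o.big_small_trans)
    show "(\<lambda>N. real (min_width (F N))) \<in> O(\<lambda>N. (80 * l N / ll N + 1) * (ll N + 4))"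
    proof (rule bigoI[of _ 1])
      show "\<forall>\<^sub>F N in sequentially. norm (real (min_width (F N))) \<le> 1 * norm ((80 * l N / ll N + 1) * (ll N + 4))"
        using ev k_bounds b_bounds
      proof eventually_elim
        case (elim N)
        have "real (min_width (F N)) \<le> real (b N * (k N + 4))" using elim(1) by (intro of_nat_mono) blast
        also have "\<dots> = real (b N) * (real (k N) + 4)" by simp
        also have "\<dots> \<le> (80 * l N / ll N + 1) * (ll N + 4)" using elim by (intro mult_mono) auto
        finally show ?case by simp
      qed
    qed
    show "(\<lambda>N. (80 * l N / ll N + 1) * (ll N + 4)) \<in> o(\<lambda>N. ln (real N) powr (3/2))"
      unfolding l_def ll_def by real_asymp
  qed
  ultimately show ?thesis by blast
qed

theorem mainTheorem3:
  shows
    "(\<exists>F :: nat \<Rightarrow> nat cnf.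
        unsat_family F \<and>
        (\<lambda>N. real (min_width (F N))) \<in> o(\<lambda>N. ln (real N)) \<and>
        (\<forall>\<^sub>F N in sequentially. \<forall>\<pi>.
           refutation (F N) \<pi> \<and> treelike \<pi> \<and>
           real (ref_width \<pi>) \<le> 1.4 * real (min_width (F N)) \<longrightarrow>
           real (ref_size \<pi>) \<ge> exp (real (cnf_size (F N)) powr 2.4)))
     \<and>
     (\<exists>F :: nat \<Rightarrow> nat cnf.
        unsat_family F \<and>
        (\<lambda>N. real (min_width (F N))) \<in> o(\<lambda>N. ln (real N) powr (3/2)) \<and>
        (\<exists>g :: nat \<Rightarrow> real. filterlim g at_top sequentially \<and>
          (\<forall>\<^sub>F N in sequentially. \<forall>\<pi>.
             refutation (F N) \<pi> \<and> treelike \<pi> \<and>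
             real (ref_width \<pi>) \<le>
               real (min_width (F N)) + 40 * (ln (real N) / ln (ln (real N))) \<longrightarrow>
             real (ref_size \<pi>) \<ge> exp (real (cnf_size (F N)) powr g N))))"
  \<comment> \<open>The values are those of \<open>R\<close>, \<open>k\<close> and \<open>b\<close>,
    in this order. As \<open>24/17\<close> barely exceeds \<open>1.4\<close>, they must be large to
    absorb the lower-order terms: \<open>14 * 1001 * 1704 < 10 * 1000 * 2399\<close>.\<close>
  using constant_width_tradeoff[of 700 1700 1001] width_plus_tradeoff by simp

end
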